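(* Let $O$ be a clone. The category $O\text{-}\mathbf{iAlg}$ of infinitesimal $O$-algebras is locally finitely presentable.
   Context: A clone $O$ consists of sets $O(n)$ for $n\in\mathbb{N}$, maps $\ast_{nk}:O(n)\times O(k)^n\to O(k)$ for all $n,k\in\mathbb{N}$, and elements $\pi^n_j\in O(n)$ for $n\ge 1$, $1\le j\le n$, such that: (associativity) $\sigma\ast_{nk}(t_1\ast_{mk}\vec s,\ldots,t_n\ast_{mk}\vec s)=(\sigma\ast_{nm}(t_1,\ldots,t_n))\ast_{mk}\vec s$ for $\sigma\in O(n)$, $t_i\in O(m)$, $\vec s\in O(k)^m$; (projection) $\pi^n_j\ast_{nm}(t_1,\ldots,t_n)=t_j$; (unit) $\sigma\ast_{nn}(\pi^n_1,\ldots,\pi^n_n)=\sigma$ for $n\geq 1$; (normalisation) $\ast_{00}(c)=c$. An i-structure on a set $A$ is a family of subsets $A\langle n\rangle\subseteq A^n$, $n\in\mathbb{N}$, with $A\langle 1\rangle=A$, $A\langle 0\rangle=A^0=1$, and such that for every map $h:m\to n$ of finite sets and $(P_1,\ldots,P_n)\in A\langle n\rangle$ we have $(P_{h(1)},\ldots,P_{h(m)})\in A\langle m\rangle$. An i-morphism $f:A\to X$ is a map with $f^n(A\langle n\rangle)\subseteq X\langle n\rangle$ for all $n$. An infinitesimal $O$-algebra (i-$O$-algebra) is a set $A$ with an i-structure and maps $\bullet_n:O(n)\times A\langle n\rangle\to A$, $n\in\mathbb{N}$, such that: (neighbourhood) for $n\ge 1$, $m\in\mathbb{N}$, $\sigma_1,\ldots,\sigma_n\in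 O(m)$ and $a\in A\langle m\rangle$, $(\sigma_1\bullet_m a,\ldots,\sigma_n\bullet_m a)\in A\langle n\rangle$; (associativity) $\sigma\bullet_n(t_1\bullet_m a,\ldots,t_n\bullet_m a)=(\sigma\ast_{nm}(t_1,\ldots,t_n))\bullet_m a$ for $\sigma\in O(n)$, $t_i\in O(m)$, $a\in A\langle m\rangle$; (projection) $\pi^n_j\bullet_n(a_1,\ldots,a_n)=a_j$ for $(a_1,\ldots,a_n)\in A\langle n\rangle$. An i-$O$-homomorphism is an i-morphism $h$ with $h(\sigma\bullet_n x)=\sigma\bullet_n h^n(x)$ for all $\sigma\in O(n)$, $x\in A\langle n\rangle$. These form the category $O\text{-}\mathbf{iAlg}$. *)

theory Defs
  imports Main "HOL-Library.FuncSet"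
begin

unbundle cardinal_syntax


section \<open>Smallness\<close>

text \<open>
  The distinction between sets and proper classes is made relative to a type \<open>'u\<close>, which plays
  the role of a universe: a set is small if it has fewer elements than \<open>'u\<close>. If the cardinality
  of \<open>'u\<close> is strongly inaccessible, then \<open>'u\<close> is, up to a bijection, a Grothendieck universe, and
  small has its usual meaning. Only the part of inaccessibility that is used is required, namely
  that the cardinality of \<open>'u\<close> is regular and uncountable; types with this property can be
  constructed in HOL, while strongly inaccessible ones cannot.
\<close>

definition universe :: "'u itself \<Rightarrow> bool" where
  "universe U \<longleftrightarrow> regularCard |UNIV :: 'u set| \<and> natLeq <o |UNIV :: 'u set|"

definition small :: "'u itself \<Rightarrow> 'a set \<Rightarrow> bool" where
  "small U X \<longleftrightarrow> |X| <o |UNIV :: 'u set|"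


section \<open>Categories\<close>

text \<open>
  Hom-sets of different pairs of objects may overlap, hence composition takes the three objects
  as arguments: \<open>Cmp C X Y Z g f\<close> is the composite of \<open>f : X \<rightarrow> Y\<close> and \<open>g : Y \<rightarrow> Z\<close>.
\<close>

record ('o, 'm) category =
  Obj :: "'o set"
  Hom :: "'o \<Rightarrow> 'o \<Rightarrow> 'm set"
  Idn :: "'o \<Rightarrow> 'm"
  Cmp :: "'o \<Rightarrow> 'o \<Rightarrow> 'o \<Rightarrow> 'm \<Rightarrow> 'm \<Rightarrow> 'm"

locale is_category =
  fixes C :: "('o, 'm) category"
  assumes idn_closed: "X \<in> Obj C \<Longrightarrow> Idn C X \<in> Hom C X X"
    and cmp_closed: "\<lbrakk>X \<in> Obj C; Y \<in> Obj C; Z \<in> Obj C; f \<in> Hom C X Y; g \<in> Hom C Y Z\<rbrakk>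
      \<Longrightarrow> Cmp C X Y Z g f \<in> Hom C X Z"
    and idn_left: "\<lbrakk>X \<in> Obj C; Y \<in> Obj C; f \<in> Hom C X Y\<rbrakk> \<Longrightarrow> Cmp C X Y Y (Idn C Y) f = f"
    and idn_right: "\<lbrakk>X \<in> Obj C; Y \<in> Obj C; f \<in> Hom C X Y\<rbrakk> \<Longrightarrow> Cmp C X X Y f (Idn C X) = f"
    and cmp_assoc: "\<lbrakk>W \<in> Obj C; X \<in> Obj C; Y \<in> Obj C; Z \<in> Obj C;
        f \<in> Hom C W X; g \<in> Hom C X Y; h \<in> Hom C Y Z\<rbrakk>
      \<Longrightarrow> Cmp C W Y Z h (Cmp C W X Y g f) = Cmp C W X Z (Cmp C X Y Z h g) f"

text \<open>The category of all sets with elements of type \<open>'a\<close> and all maps between them.\<close>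

definition SET :: "('a set, 'a \<Rightarrow> 'a) category" where
  "SET = \<lparr>Obj = UNIV, Hom = (\<lambda>X Y. X \<rightarrow>\<^sub>E Y), Idn = (\<lambda>X. \<lambda>x\<in>X. x),
          Cmp = (\<lambda>X Y Z g f. compose X g f)\<rparr>"

locale is_functor = dom: is_category J + cod: is_category C
  for J :: "('i, 'j) category" and C :: "('o, 'm) category"
  + fixes D :: "'i \<Rightarrow> 'o" and Da :: "'i \<Rightarrow> 'i \<Rightarrow> 'j \<Rightarrow> 'm"
  assumes obj_closed: "i \<in> Obj J \<Longrightarrow> D i \<in> Obj C"
    and arr_closed: "\<lbrakk>i \<in> Obj J; j \<in> Obj J; u \<in> Hom J i j\<rbrakk> \<Longrightarrow> Da i j u \<in> Hom C (D i) (D j)"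
    and pres_idn: "i \<in> Obj J \<Longrightarrow> Da i i (Idn J i) = Idn C (D i)"
    and pres_cmp: "\<lbrakk>i \<in> Obj J; j \<in> Obj J; k \<in> Obj J; u \<in> Hom J i j; v \<in> Hom J j k\<rbrakk>
      \<Longrightarrow> Da i k (Cmp J i j k v u) = Cmp C (D i) (D j) (D k) (Da j k v) (Da i j u)"

definition is_cocone ::
  "('i, 'j) category \<Rightarrow> ('o, 'm) category \<Rightarrow> ('i \<Rightarrow> 'o) \<Rightarrow> ('i \<Rightarrow> 'i \<Rightarrow> 'j \<Rightarrow> 'm)
    \<Rightarrow> 'o \<Rightarrow> ('i \<Rightarrow> 'm) \<Rightarrow> bool" where
  "is_cocone J C D Da c l \<longleftrightarrow>
     c \<in> Obj C \<and> (\<forall>i\<in>Obj J. l i \<in> Hom C (D i) c) \<and>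
     (\<forall>i\<in>Obj J. \<forall>j\<in>Obj J. \<forall>u\<in>Hom J i j. Cmp C (D i) (D j) c (l j) (Da i j u) = l i)"

definition is_colimit ::
  "('i, 'j) category \<Rightarrow> ('o, 'm) category \<Rightarrow> ('i \<Rightarrow> 'o) \<Rightarrow> ('i \<Rightarrow> 'i \<Rightarrow> 'j \<Rightarrow> 'm)
    \<Rightarrow> 'o \<Rightarrow> ('i \<Rightarrow> 'm) \<Rightarrow> bool" where
  "is_colimit J C D Da c l \<longleftrightarrow>
     is_cocone J C D Da c l \<and>
     (\<forall>c' l'. is_cocone J C D Da c' l' \<longrightarrow>
        (\<exists>!m. m \<in> Hom C c c' \<and> (\<forall>i\<in>Obj J. Cmp C (D i) c c' m (l i) = l' i)))"


section \<open>Locally finitely presentable categories\<close>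

text \<open>
  Up to isomorphism, every small category has its objects and arrows in \<open>'u\<close>, so diagrams may be
  restricted to shapes of type \<open>('u, 'u) category\<close>.
\<close>

definition small_category :: "('u, 'u) category \<Rightarrow> bool" where
  "small_category J \<longleftrightarrow> is_category J \<and> small TYPE('u) (Obj J) \<and>
     (\<forall>i\<in>Obj J. \<forall>j\<in>Obj J. small TYPE('u) (Hom J i j))"

text \<open>A nonempty directed poset, regarded as a category.\<close>

definition directed_poset :: "('i, 'j) category \<Rightarrow> bool" where
  "directed_poset J \<longleftrightarrow> is_category J \<and>
     (\<forall>i\<in>Obj J. \<forall>j\<in>Obj J. \<forall>u\<in>Hom J i j. \<forall>v\<in>Hom J i j. u = v) \<and>
     (\<forall>i\<in>Obj J. \<forall>j\<in>Obj J. Hom J i j \<noteq> {} \<and> Hom J j i \<noteq> {} \<longrightarrow> i = j) \<and>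
     Obj J \<noteq> {} \<and>
     (\<forall>i\<in>Obj J. \<forall>j\<in>Obj J. \<exists>k\<in>Obj J. Hom J i k \<noteq> {} \<and> Hom J j k \<noteq> {})"

text \<open>
  If the cardinality of \<open>'u\<close> is a strong limit, the following says precisely that all hom-sets
  are small. For a universe that is merely regular, power sets of small sets need not be small, and
  it says that hom-sets are no larger than such power sets.
\<close>

definition locally_small :: "'u itself \<Rightarrow> ('o, 'm) category \<Rightarrow> bool" where
  "locally_small U C \<longleftrightarrow>
     (\<forall>X\<in>Obj C. \<forall>Y\<in>Obj C. \<exists>B :: 'u set. small U B \<and> |Hom C X Y| \<le>o |Pow B| )"

definition cocomplete :: "'u itself \<Rightarrow> ('o, 'm) category \<Rightarrow> bool" where
  "cocomplete U C \<longleftrightarrow>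
     (\<forall>(J :: ('u, 'u) category) D Da. small_category J \<and> is_functor J C D Da \<longrightarrow>
        (\<exists>c l. is_colimit J C D Da c l))"

text \<open>
  \<open>K\<close> is finitely presentable if the functor \<open>Hom(K, -)\<close> into sets preserves small directed
  colimits. Its values are sets over the arrow type \<open>'m\<close> of \<open>C\<close>, so the colimit is taken in
  the category of these sets. As soon as \<open>'m\<close> has two elements, this is the same as a
  colimit in sets of arbitrary size, because maps into a two-element set detect whether the
  comparison map from the true colimit is bijective.
\<close>

definition finitely_presentable :: "'u itself \<Rightarrow> ('o, 'm) category \<Rightarrow> 'o \<Rightarrow> bool" where
  "finitely_presentable U C K \<longleftrightarrow> K \<in> Obj C \<and>
     (\<forall>(J :: ('u, 'u) category) D Da c l.
        small_category J \<and> directed_poset J \<and> is_functor J C D Da \<and> is_colimit J C D Da c l \<longrightarrow>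
        is_colimit J SET
          (\<lambda>i. Hom C K (D i))
          (\<lambda>i j u. \<lambda>h\<in>Hom C K (D i). Cmp C K (D i) (D j) (Da i j u) h)
          (Hom C K c)
          (\<lambda>i. \<lambda>h\<in>Hom C K (D i). Cmp C K (D i) c (l i) h))"

definition locally_finitely_presentable :: "'u itself \<Rightarrow> ('o, 'm) category \<Rightarrow> bool" where
  "locally_finitely_presentable U C \<longleftrightarrow>
     is_category C \<and> locally_small U C \<and> cocomplete U C \<and>
     (\<exists>S. small U S \<and> (\<forall>K\<in>S. finitely_presentable U C K) \<and>
        (\<forall>X\<in>Obj C. \<exists>(J :: ('u, 'u) category) D Da l.
           small_category J \<and> directed_poset J \<and> is_functor J C D Da \<and>
           (\<forall>i\<in>Obj J. D i \<in> S) \<and> is_colimit J C D Da X l))"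


section \<open>Clones\<close>

text \<open>
  Tuples are lists and are indexed from 0, so \<open>prj \<O> n j\<close> with \<open>j < n\<close> is the projection usually
  written \<open>\<pi>\<^sup>n\<close> with index \<open>j + 1\<close>. The sets \<open>Ops \<O> n\<close> need not be disjoint, and the
  target arity of \<open>sub \<O> n k\<close> cannot be read off from an empty tuple; so the arities are explicit.
\<close>

record 'f clone =
  Ops :: "nat \<Rightarrow> 'f set"
  sub :: "nat \<Rightarrow> nat \<Rightarrow> 'f \<Rightarrow> 'f list \<Rightarrow> 'f"
  prj :: "nat \<Rightarrow> nat \<Rightarrow> 'f"

definition tuples :: "'a set \<Rightarrow> nat \<Rightarrow> 'a list set" where
  "tuples A n = {xs. length xs = n \<and> set xs \<subseteq> A}"

locale is_clone =
  fixes \<O> :: "'f clone"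
  assumes sub_closed: "\<lbrakk>\<sigma> \<in> Ops \<O> n; ts \<in> tuples (Ops \<O> k) n\<rbrakk> \<Longrightarrow> sub \<O> n k \<sigma> ts \<in> Ops \<O> k"
    and prj_closed: "j < n \<Longrightarrow> prj \<O> n j \<in> Ops \<O> n"
    and associativity:
      "\<lbrakk>\<sigma> \<in> Ops \<O> n; ts \<in> tuples (Ops \<O> m) n; ss \<in> tuples (Ops \<O> k) m\<rbrakk>
       \<Longrightarrow> sub \<O> n k \<sigma> (map (\<lambda>t. sub \<O> m k t ss) ts) = sub \<O> m k (sub \<O> n m \<sigma> ts) ss"
    and projection: "\<lbrakk>j < n; ts \<in> tuples (Ops \<O> m) n\<rbrakk> \<Longrightarrow> sub \<O> n m (prj \<O> n j) ts = ts ! j"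
    and unit: "\<lbrakk>n \<ge> 1; \<sigma> \<in> Ops \<O> n\<rbrakk> \<Longrightarrow> sub \<O> n n \<sigma> (map (prj \<O> n) [0..<n]) = \<sigma>"
    and normalisation: "c \<in> Ops \<O> 0 \<Longrightarrow> sub \<O> 0 0 c [] = c"


section \<open>Infinitesimal algebras\<close>

text \<open>
  \<open>Nbh A n\<close> is the set \<open>A\<langle>n\<rangle>\<close> of the i-structure. The value of \<open>act A n \<sigma> xs\<close> is irrelevant
  unless \<open>\<sigma>\<close> is an \<open>n\<close>-ary operation and \<open>xs \<in> Nbh A n\<close>.
\<close>

record ('f, 'a) ialg =
  carr :: "'a set"
  Nbh :: "nat \<Rightarrow> 'a list set"
  act :: "nat \<Rightarrow> 'f \<Rightarrow> 'a list \<Rightarrow> 'a"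

locale i_structure =
  fixes A :: "'a set" and N :: "nat \<Rightarrow> 'a list set"
  assumes nbh_subset: "N n \<subseteq> tuples A n"
    and nbh_1: "N 1 = tuples A 1"
    and nbh_0: "N 0 = tuples A 0"
    and nbh_reindex: "\<lbrakk>h \<in> {..<m} \<rightarrow> {..<n}; xs \<in> N n\<rbrakk> \<Longrightarrow> map (\<lambda>i. xs ! h i) [0..<m] \<in> N m"

text \<open>Maps between carriers are extensional, so that equality of morphisms is equality in HOL.\<close>

definition i_morphism ::
  "'a set \<Rightarrow> (nat \<Rightarrow> 'a list set) \<Rightarrow> 'b set \<Rightarrow> (nat \<Rightarrow> 'b list set) \<Rightarrow> ('a \<Rightarrow> 'b) \<Rightarrow> bool" where
  "i_morphism A N B M f \<longleftrightarrow> f \<in> A \<rightarrow>\<^sub>E B \<and> (\<forall>n. map f ` N n \<subseteq> M n)"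

locale i_algebra = i_structure "carr A" "Nbh A"
  for \<O> :: "'f clone" and A :: "('f, 'a) ialg" +
  assumes act_closed: "\<lbrakk>\<sigma> \<in> Ops \<O> n; xs \<in> Nbh A n\<rbrakk> \<Longrightarrow> act A n \<sigma> xs \<in> carr A"
    and neighbourhood:
      "\<lbrakk>n \<ge> 1; ss \<in> tuples (Ops \<O> m) n; xs \<in> Nbh A m\<rbrakk> \<Longrightarrow> map (\<lambda>s. act A m s xs) ss \<in> Nbh A n"
    and associativity:
      "\<lbrakk>\<sigma> \<in> Ops \<O> n; ts \<in> tuples (Ops \<O> m) n; xs \<in> Nbh A m\<rbrakk>
       \<Longrightarrow> act A n \<sigma> (map (\<lambda>t. act A m t xs) ts) = act A m (sub \<O> n m \<sigma> ts) xs"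
    and projection: "\<lbrakk>j < n; xs \<in> Nbh A n\<rbrakk> \<Longrightarrow> act A n (prj \<O> n j) xs = xs ! j"

definition i_homomorphism ::
  "'f clone \<Rightarrow> ('f, 'a) ialg \<Rightarrow> ('f, 'b) ialg \<Rightarrow> ('a \<Rightarrow> 'b) \<Rightarrow> bool" where
  "i_homomorphism \<O> A B h \<longleftrightarrow> i_morphism (carr A) (Nbh A) (carr B) (Nbh B) h \<and>
     (\<forall>n. \<forall>\<sigma>\<in>Ops \<O> n. \<forall>xs\<in>Nbh A n. h (act A n \<sigma> xs) = act B n \<sigma> (map h xs))"

text \<open>
  The category of small i-algebras. Every small i-algebra is isomorphic to one whose carrier
  consists of elements of \<open>'u\<close>.
\<close>

definition iAlg :: "'f clone \<Rightarrow> (('f, 'u) ialg, 'u \<Rightarrow> 'u) category" where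
  "iAlg \<O> =
    \<lparr>Obj = {A. i_algebra \<O> A \<and> small TYPE('u) (carr A)},
     Hom = (\<lambda>A B. {h. i_homomorphism \<O> A B h}),
     Idn = (\<lambda>A. \<lambda>x\<in>carr A. x),
     Cmp = (\<lambda>A B C g f. compose (carr A) g f)\<rparr>"

end

(* In an i-algebra operations are only applied to neighbourhoods, so a quotient of a disjoint union of
   i-algebras by a congruence is again an i-algebra whose neighbourhoods are the images of the given
   ones. All small colimits arise in this way; for a directed diagram the congruence is eventual
   equality, hence a neighbourhood of a directed colimit lifts to a stage, and two elements that agree
   in the colimit agree at a stage. The set of n-ary operations with all tuples as neighbourhoods
   represents the functor A |-> A<n>, so quotients of disjoint unions of such algebras give an algebra for every
   presentation by generating neighbourhoods and relations, and a finite presentation gives a finitely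
   presentable algebra. Finally, X is the directed colimit of the algebras presented by the finite sets
   of relations that hold between neighbourhoods of X. *)

theory Submission
  imports Defs
begin

section \<open>Small sets\<close>

text \<open>Apart from eventual equality, no congruence here is generated from inside by closing a
  set of pairs. Points are identified when every test identifies them, a test being a cocone of the
  diagram or a family of neighbourhoods satisfying the relations. Compatibility with the operations
  is inherited from the tests, and factorisation through the quotient is immediate. The tests are
  too many to form a small set, but the points are not, so the classes can be named by elements of
  \<open>'u\<close>; this keeps the quotient inside the universe. Generators are neighbourhoods and
  not elements, because a homomorphism must carry given tuples to neighbourhoods, which prescribing
  the images of their entries would not guarantee. The diagram over \<open>X\<close> is indexed by
  finite sets of relations alone, the generators being read off from them. This gives a poset
  directed under union, with no passage from a filtered category to a directed one. Finiteness
  serves twice: it makes the stages finitely presentable, and it keeps the index small in a universe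
  that need not be closed under power sets.\<close>

lemma small_subset: "A \<subseteq> B \<Longrightarrow> small U B \<Longrightarrow> small U A"
  unfolding small_def using card_of_mono1 ordLeq_ordLess_trans by blast

lemma small_image: "small U A \<Longrightarrow> small U (f ` A)"
  unfolding small_def using card_of_image ordLeq_ordLess_trans by blast

lemma universe_Cinfinite:
  assumes "universe TYPE('u)"
  shows "Cinfinite |UNIV :: 'u set|"
proof -
  have "natLeq \<le>o |UNIV :: 'u set|"
    using assms ordLess_imp_ordLeq unfolding universe_def by blast
  then have "infinite (UNIV :: 'u set)"
    using infinite_iff_natLeq_ordLeq by blast
  then show ?thesis
    unfolding cinfinite_def by (intro conjI card_of_Card_order) (simp add: Field_card_of)
qed

text \<open>This is where regularity of the universe enters; the other closure properties of small
  sets are reduced to it.\<close>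

lemma small_UN:
  assumes "universe TYPE('u)" "small TYPE('u) I" "\<And>i. i \<in> I \<Longrightarrow> small TYPE('u) (A i)"
  shows "small TYPE('u) (\<Union>i\<in>I. A i)"
  using assms card_of_UNION_ordLess_infinite_Field_regularCard[of "|UNIV :: 'u set|" I A]
    universe_Cinfinite[OF assms(1)]
  unfolding small_def universe_def by simp

lemma small_finite:
  assumes "universe TYPE('u)" "finite A"
  shows "small TYPE('u) A"
proof -
  have "infinite (Field |UNIV :: 'u set| )"
    using universe_Cinfinite[OF assms(1)] by (simp add: cinfinite_def)
  then show ?thesis
    unfolding small_def
    using finite_ordLess_infinite[OF card_of_Well_order card_of_Well_order] assms(2)
    by (simp add: Field_card_of)
qed

lemma small_Sigma:
  assumes "universe TYPE('u)" "small TYPE('u) I" "\<And>i. i \<in> I \<Longrightarrow> small TYPE('u) (A i)"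
  shows "small TYPE('u) (Sigma I A)"
proof -
  have "Sigma I A = (\<Union>i\<in>I. Pair i ` A i)" by auto
  then show ?thesis using assms by (simp add: small_UN small_image)
qed

lemma small_tuples:
  assumes "universe TYPE('u)" "small TYPE('u) A"
  shows "small TYPE('u) (tuples A n)"
proof (induction n)
  case 0
  have "tuples A 0 = {[]}" by (auto simp: tuples_def)
  then show ?case using assms by (simp add: small_finite)
next
  case (Suc n)
  have "tuples A (Suc n) \<subseteq> (\<lambda>(x, xs). x # xs) ` (A \<times> tuples A n)"
    by (auto simp: tuples_def length_Suc_conv)
  moreover have "small TYPE('u) (A \<times> tuples A n)"
    using Suc by (intro small_Sigma[OF assms])
  ultimately show ?case using small_subset small_image by blast
qed

lemma small_nat:
  assumes "universe TYPE('u)"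
  shows "small TYPE('u) (A :: nat set)"
proof (rule small_subset[OF subset_UNIV])
  show "small TYPE('u) (UNIV :: nat set)"
    using assms card_of_nat ordIso_ordLess_trans unfolding small_def universe_def by blast
qed

lemma small_lists:
  assumes "universe TYPE('u)" "small TYPE('u) A"
  shows "small TYPE('u) (lists A)"
proof -
  have "lists A = (\<Union>n. tuples A n)" by (auto simp: tuples_def lists_eq_set)
  then show ?thesis using assms by (simp add: small_UN small_nat small_tuples)
qed

text \<open>A finite subset is the set of entries of some list, so lists bound the number of finite
  subsets. The full power set of a small set may fail to be small.\<close>

lemma small_Fpow:
  assumes "universe TYPE('u)" "small TYPE('u) A"
  shows "small TYPE('u) (Fpow A)"
proof -
  have "X \<in> set ` lists A" if X: "X \<subseteq> A" "finite X" for X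
  proof -
    obtain xs where "set xs = X" using finite_list[OF X(2)] by blast
    then show ?thesis using X(1) by (auto simp: lists_eq_set)
  qed
  then have "Fpow A \<subseteq> set ` lists A" by (auto simp: Fpow_def)
  then show ?thesis by (rule small_subset[OF _ small_image[OF small_lists[OF assms]]])
qed

lemma small_encoding:
  assumes "small TYPE('u) A"
  obtains e :: "'a \<Rightarrow> 'u" where "inj_on e A"
proof -
  have "|A| \<le>o |UNIV :: 'u set|"
    using assms ordLess_imp_ordLeq unfolding small_def by blast
  then show thesis using that unfolding card_of_ordLeq[symmetric] by blast
qed

text \<open>Produces all quotients below. The map \<open>k\<close> may take values in a huge type,
  for instance functions on all cocones, but its image on a small set is small and hence can be
  renamed by elements of \<open>'u\<close> without changing the kernel.\<close>

lemma small_kernel: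
  assumes "small TYPE('u) A"
  obtains q :: "'a \<Rightarrow> 'u" where "\<And>x y. x \<in> A \<Longrightarrow> y \<in> A \<Longrightarrow> q x = q y \<longleftrightarrow> k x = k y"
proof -
  obtain e :: "_ \<Rightarrow> 'u" where "inj_on e (k ` A)"
    using small_encoding[OF small_image[OF assms]] .
  then show thesis by (intro that[of "e \<circ> k"]) (auto simp: inj_on_def)
qed


section \<open>Homomorphisms\<close>

lemma hom_carr: "i_homomorphism \<O> A B h \<Longrightarrow> x \<in> carr A \<Longrightarrow> h x \<in> carr B"
  by (auto simp: i_homomorphism_def i_morphism_def)

lemma hom_nbh: "i_homomorphism \<O> A B h \<Longrightarrow> xs \<in> Nbh A n \<Longrightarrow> map h xs \<in> Nbh B n"
  by (auto simp: i_homomorphism_def i_morphism_def)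

lemma hom_act:
  "i_homomorphism \<O> A B h \<Longrightarrow> \<sigma> \<in> Ops \<O> n \<Longrightarrow> xs \<in> Nbh A n
    \<Longrightarrow> h (act A n \<sigma> xs) = act B n \<sigma> (map h xs)"
  by (auto simp: i_homomorphism_def)

lemma homI:
  assumes "h \<in> extensional (carr A)"
    and "\<And>x. x \<in> carr A \<Longrightarrow> h x \<in> carr B"
    and "\<And>n xs. xs \<in> Nbh A n \<Longrightarrow> map h xs \<in> Nbh B n"
    and "\<And>n \<sigma> xs. \<sigma> \<in> Ops \<O> n \<Longrightarrow> xs \<in> Nbh A n \<Longrightarrow> h (act A n \<sigma> xs) = act B n \<sigma> (map h xs)"
  shows "i_homomorphism \<O> A B h"
  using assms by (auto simp: i_homomorphism_def i_morphism_def PiE_def)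

lemma hom_eqI:
  assumes "i_homomorphism \<O> A B h" "i_homomorphism \<O> A B h'"
    and "\<And>x. x \<in> carr A \<Longrightarrow> h x = h' x"
  shows "h = h'"
  using assms PiE_ext by (metis i_homomorphism_def i_morphism_def)

context i_structure
begin

lemma nbh_length: "xs \<in> N n \<Longrightarrow> length xs = n"
  using nbh_subset by (auto simp: tuples_def)

lemma nbh_set: "xs \<in> N n \<Longrightarrow> set xs \<subseteq> A"
  using nbh_subset by (auto simp: tuples_def)

lemma nbh_nth: "xs \<in> N n \<Longrightarrow> j < n \<Longrightarrow> xs ! j \<in> A"
  using nbh_length nbh_set nth_mem by blast

lemma nbh_single: "[x] \<in> N 1 \<longleftrightarrow> x \<in> A"
  using nbh_1 by (auto simp: tuples_def)

lemma nbh_Nil: "xs \<in> N 0 \<longleftrightarrow> xs = []"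
  using nbh_0 by (auto simp: tuples_def)

end

lemma hom_idn:
  assumes "i_algebra \<O> A"
  shows "i_homomorphism \<O> A A (\<lambda>x\<in>carr A. x)"
proof -
  interpret i_algebra \<O> A by fact
  have "map (\<lambda>x\<in>carr A. x) xs = xs" if "xs \<in> Nbh A n" for xs n
    using nbh_set[OF that] by (intro map_idI) auto
  then show ?thesis by (intro homI) (auto simp: act_closed)
qed

text \<open>Used to turn equality of two tuples in a quotient into equality of their values under a
  test, entry by entry.\<close>

lemma map_eq_map:
  assumes "map f xs = map f' ys"
    and "\<And>x y. \<lbrakk>x \<in> set xs; y \<in> set ys; f x = f' y\<rbrakk> \<Longrightarrow> g x = g' y"
  shows "map g xs = map g' ys"
  using assms by (induction xs arbitrary: ys) (auto simp: Cons_eq_map_conv)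

lemma map_compose:
  assumes "set xs \<subseteq> A"
  shows "map (compose A g f) xs = map g (map f xs)"
  using assms by (auto simp: compose_def)

lemma hom_compose:
  assumes "i_algebra \<O> A" "i_homomorphism \<O> A B f" "i_homomorphism \<O> B C g"
  shows "i_homomorphism \<O> A C (compose (carr A) g f)"
proof -
  interpret i_algebra \<O> A by fact
  have *: "map (compose (carr A) g f) xs = map g (map f xs)" if "xs \<in> Nbh A n" for xs n
    using nbh_set[OF that] by (rule map_compose)
  show ?thesis
    using assms(2,3)
    by (intro homI) (simp_all only: * hom_nbh hom_act compose_extensional compose_eq act_closed hom_carr)
qed

section \<open>The category of small i-algebras\<close>

lemma iAlg_Obj: "A \<in> Obj (iAlg \<O> :: (('f, 'u) ialg, 'u \<Rightarrow> 'u) category) \<longleftrightarrow> i_algebra \<O> A \<and> small TYPE('u) (carr A)"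
  by (simp add: iAlg_def)

lemma iAlg_Hom: "h \<in> Hom (iAlg \<O>) A B \<longleftrightarrow> i_homomorphism \<O> A B h"
  by (simp add: iAlg_def)

lemma iAlg_Idn: "Idn (iAlg \<O>) A = (\<lambda>x\<in>carr A. x)"
  by (simp add: iAlg_def)

lemma iAlg_Cmp: "Cmp (iAlg \<O>) A B C g f = compose (carr A) g f"
  by (simp add: iAlg_def)

lemma hom_extensional: "i_homomorphism \<O> A B h \<Longrightarrow> h \<in> extensional (carr A)"
  by (auto simp: i_homomorphism_def i_morphism_def PiE_def)

lemma iAlg_category: "is_category (iAlg \<O> :: (('f, 'u) ialg, 'u \<Rightarrow> 'u) category)"
proof
  fix W X Y Z :: "('f, 'u) ialg" and f g h :: "'u \<Rightarrow> 'u"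
  let ?C = "iAlg \<O> :: (('f, 'u) ialg, 'u \<Rightarrow> 'u) category"
  show "X \<in> Obj ?C \<Longrightarrow> Idn ?C X \<in> Hom ?C X X"
    by (simp add: iAlg_Obj iAlg_Hom iAlg_Idn hom_idn)
  show "X \<in> Obj ?C \<Longrightarrow> f \<in> Hom ?C X Y \<Longrightarrow> g \<in> Hom ?C Y Z \<Longrightarrow> Cmp ?C X Y Z g f \<in> Hom ?C X Z"
    by (auto simp: iAlg_Obj iAlg_Hom iAlg_Cmp intro: hom_compose)
  show "f \<in> Hom ?C X Y \<Longrightarrow> Cmp ?C X Y Y (Idn ?C Y) f = f"
    by (rule extensionalityI[of _ "carr X"])
      (auto simp: iAlg_Hom iAlg_Idn iAlg_Cmp compose_eq hom_carr hom_extensional)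
  show "f \<in> Hom ?C X Y \<Longrightarrow> Cmp ?C X X Y f (Idn ?C X) = f"
    by (rule extensionalityI[of _ "carr X"])
      (auto simp: iAlg_Hom iAlg_Idn iAlg_Cmp compose_eq hom_carr hom_extensional)
  show "f \<in> Hom ?C W X \<Longrightarrow>
    Cmp ?C W Y Z h (Cmp ?C W X Y g f) = Cmp ?C W X Z (Cmp ?C X Y Z h g) f"
    by (rule extensionalityI[of _ "carr W"])
      (auto simp: iAlg_Hom iAlg_Cmp compose_eq hom_carr)
qed

text \<open>A homomorphism is determined by its graph, a subset of the small set
  \<open>carr X \<times> carr Y\<close>; the injection \<open>e\<close> only moves this product into
  \<open>'u\<close>.\<close>

lemma iAlg_locally_small:
  assumes "universe TYPE('u)"
  shows "locally_small TYPE('u) (iAlg \<O> :: (('f, 'u) ialg, 'u \<Rightarrow> 'u) category)"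
  unfolding locally_small_def
proof (intro ballI)
  fix X Y assume "X \<in> Obj (iAlg \<O> :: (('f, 'u) ialg, 'u \<Rightarrow> 'u) category)"
    and "Y \<in> Obj (iAlg \<O> :: (('f, 'u) ialg, 'u \<Rightarrow> 'u) category)"
  then have sm: "small TYPE('u) (carr X \<times> carr Y)"
    by (simp add: iAlg_Obj small_Sigma[OF assms])
  then obtain e :: "'u \<times> 'u \<Rightarrow> 'u" where e: "inj_on e (carr X \<times> carr Y)"
    by (rule small_encoding)
  define graph where "graph f = (\<lambda>x. (x, f x)) ` carr X" for f :: "'u \<Rightarrow> 'u"
  have sub: "graph f \<subseteq> carr X \<times> carr Y" if "f \<in> Hom (iAlg \<O>) X Y" for f
    using that by (auto simp: graph_def iAlg_Hom hom_carr)
  have "inj_on (\<lambda>f. e ` graph f) (Hom (iAlg \<O>) X Y)"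
  proof (rule inj_onI)
    fix f g assume fg: "f \<in> Hom (iAlg \<O>) X Y" "g \<in> Hom (iAlg \<O>) X Y" "e ` graph f = e ` graph g"
    then have eq: "graph f = graph g"
      by (simp add: inj_on_image_eq_iff[OF e sub sub])
    show "f = g"
    proof (rule hom_eqI)
      show "i_homomorphism \<O> X Y f" "i_homomorphism \<O> X Y g"
        using fg by (simp_all add: iAlg_Hom)
      fix x assume "x \<in> carr X"
      then have "(x, f x) \<in> graph g" using eq by (auto simp: graph_def)
      then show "f x = g x" by (auto simp: graph_def)
    qed
  qed
  moreover have "(\<lambda>f. e ` graph f) ` Hom (iAlg \<O>) X Y \<subseteq> Pow (e ` (carr X \<times> carr Y))"
    using sub by auto
  ultimately have "|Hom (iAlg \<O>) X Y| \<le>o |Pow (e ` (carr X \<times> carr Y))|"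
    using card_of_ordLeq by blast
  then show "\<exists>B :: 'u set. small TYPE('u) B \<and> |Hom (iAlg \<O>) X Y| \<le>o |Pow B|"
    using small_image[OF sm] by blast
qed

section \<open>Quotients of disjoint unions\<close>

text \<open>The quotient of the disjoint union is encoded by maps \<open>q i\<close> with a common
  codomain: the points \<open>x\<close> of \<open>B i\<close> and \<open>y\<close> of
  \<open>B j\<close> are identified when \<open>q i x = q j y\<close>. The choice in
  \<open>act\<close> is harmless under the congruence condition of \<open>glueing\<close>.\<close>

definition glue :: "'i set \<Rightarrow> ('i \<Rightarrow> ('f, 'a) ialg) \<Rightarrow> ('i \<Rightarrow> 'a \<Rightarrow> 'b) \<Rightarrow> ('f, 'b) ialg" where
  "glue I B q = \<lparr>carr = (\<Union>i\<in>I. q i ` carr (B i)), Nbh = (\<lambda>n. \<Union>i\<in>I. map (q i) ` Nbh (B i) n),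
     act = (\<lambda>n \<sigma> zs. SOME z. \<exists>i\<in>I. \<exists>xs\<in>Nbh (B i) n. zs = map (q i) xs \<and> z = q i (act (B i) n \<sigma> xs))\<rparr>"

text \<open>Each neighbourhood of the quotient is the image of one from a single summand, so
  \<open>congruence\<close>, which compares two summands at a time, is exactly independence of
  \<open>act\<close> from the representative. A summand must exist because the empty tuple has to be
  a neighbourhood.\<close>

locale glueing =
  fixes \<O> :: "'f clone" and I :: "'i set" and B :: "'i \<Rightarrow> ('f, 'a) ialg" and q :: "'i \<Rightarrow> 'a \<Rightarrow> 'b"
  assumes clone: "is_clone \<O>"
    and nonempty: "I \<noteq> {}"
    and alg: "i \<in> I \<Longrightarrow> i_algebra \<O> (B i)"
    and congruence: "\<lbrakk>i \<in> I; j \<in> I; \<sigma> \<in> Ops \<O> n; xs \<in> Nbh (B i) n; ys \<in> Nbh (B j) n;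
        map (q i) xs = map (q j) ys\<rbrakk>
      \<Longrightarrow> q i (act (B i) n \<sigma> xs) = q j (act (B j) n \<sigma> ys)"
begin

lemma glue_carrI: "i \<in> I \<Longrightarrow> x \<in> carr (B i) \<Longrightarrow> q i x \<in> carr (glue I B q)"
  by (auto simp: glue_def)

lemma glue_carrE:
  assumes "z \<in> carr (glue I B q)"
  obtains i x where "i \<in> I" "x \<in> carr (B i)" "z = q i x"
  using assms by (auto simp: glue_def)

lemma glue_NbhI: "i \<in> I \<Longrightarrow> xs \<in> Nbh (B i) n \<Longrightarrow> map (q i) xs \<in> Nbh (glue I B q) n"
  by (auto simp: glue_def)

lemma glue_NbhE:
  assumes "zs \<in> Nbh (glue I B q) n"
  obtains i xs where "i \<in> I" "xs \<in> Nbh (B i) n" "zs = map (q i) xs"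
  using assms by (auto simp: glue_def)

lemma glue_act:
  assumes "i \<in> I" "xs \<in> Nbh (B i) n" "\<sigma> \<in> Ops \<O> n"
  shows "act (glue I B q) n \<sigma> (map (q i) xs) = q i (act (B i) n \<sigma> xs)"
proof -
  have "(SOME z. \<exists>j\<in>I. \<exists>ys\<in>Nbh (B j) n. map (q i) xs = map (q j) ys \<and> z = q j (act (B j) n \<sigma> ys))
    = q i (act (B i) n \<sigma> xs)"
    by (rule some_equality) (use assms congruence[OF assms(1) _ assms(3,2)] in metis)+
  then show ?thesis by (simp add: glue_def)
qed

text \<open>Every axiom speaks of one neighbourhood at a time. It lifts to a neighbourhood of one
  summand, where the axiom holds, and the result is pushed down along \<open>q\<close>. Total
  operations would require tuples with entries from several summands.\<close>

lemma glue_algebra: "i_algebra \<O> (glue I B q)"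
proof
  let ?E = "glue I B q"
  show Nbh_subset: "Nbh ?E n \<subseteq> tuples (carr ?E) n" for n
  proof
    fix zs assume "zs \<in> Nbh ?E n"
    then obtain i xs where i: "i \<in> I" "xs \<in> Nbh (B i) n" "zs = map (q i) xs"
      by (rule glue_NbhE)
    interpret i_algebra \<O> "B i" using alg i by blast
    show "zs \<in> tuples (carr ?E) n"
      using i nbh_length[OF i(2)] nbh_set[OF i(2)] by (auto simp: tuples_def intro: glue_carrI)
  qed
  show "Nbh ?E 1 = tuples (carr ?E) 1"
  proof
    show "tuples (carr ?E) 1 \<subseteq> Nbh ?E 1"
    proof
      fix zs assume "zs \<in> tuples (carr ?E) 1"
      then obtain z where z: "zs = [z]" "z \<in> carr ?E"
        by (auto simp: tuples_def length_Suc_conv)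
      from z(2) obtain i x where i: "i \<in> I" "x \<in> carr (B i)" "z = q i x"
        by (rule glue_carrE)
      interpret i_algebra \<O> "B i" using alg i by blast
      have "[x] \<in> Nbh (B i) 1" using i(2) by (simp only: nbh_single)
      from glue_NbhI[OF i(1) this] show "zs \<in> Nbh ?E 1" using i(3) z(1) by simp
    qed
  qed (rule Nbh_subset)
  show "Nbh ?E 0 = tuples (carr ?E) 0"
  proof
    obtain i where "i \<in> I" using nonempty by blast
    interpret i_algebra \<O> "B i" using alg \<open>i \<in> I\<close> by blast
    have "[] \<in> Nbh (B i) 0" by (simp add: nbh_Nil)
    from glue_NbhI[OF \<open>i \<in> I\<close> this] have "[] \<in> Nbh ?E 0" by simp
    then show "tuples (carr ?E) 0 \<subseteq> Nbh ?E 0" by (auto simp: tuples_def)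
  qed (rule Nbh_subset)
  show "map (\<lambda>i. zs ! h i) [0..<m] \<in> Nbh ?E m"
    if h: "h \<in> {..<m} \<rightarrow> {..<n}" and zs: "zs \<in> Nbh ?E n" for h m n zs
  proof -
    obtain i xs where i: "i \<in> I" "xs \<in> Nbh (B i) n" "zs = map (q i) xs"
      using zs by (rule glue_NbhE)
    interpret i_algebra \<O> "B i" using alg i by blast
    have "map (\<lambda>i. zs ! h i) [0..<m] = map (q i) (map (\<lambda>i. xs ! h i) [0..<m])"
      using h nbh_length[OF i(2)] i(3) by (auto simp: Pi_iff)
    then show ?thesis using glue_NbhI[OF i(1) nbh_reindex[OF h i(2)]] by (simp only:)
  qed
  show "act ?E n \<sigma> zs \<in> carr ?E" if \<sigma>: "\<sigma> \<in> Ops \<O> n" and zs: "zs \<in> Nbh ?E n" for n \<sigma> zs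
  proof -
    obtain i xs where i: "i \<in> I" "xs \<in> Nbh (B i) n" "zs = map (q i) xs"
      using zs by (rule glue_NbhE)
    interpret i_algebra \<O> "B i" using alg i by blast
    show ?thesis using i glue_act[OF i(1,2) \<sigma>] glue_carrI[OF i(1) act_closed[OF \<sigma> i(2)]] by simp
  qed
  have map_act: "map (\<lambda>s. act ?E m s (map (q i) xs)) ss = map (q i) (map (\<lambda>s. act (B i) m s xs) ss)"
    if "i \<in> I" "xs \<in> Nbh (B i) m" "ss \<in> tuples (Ops \<O> m) n" for i xs ss m n
    using that glue_act by (auto simp: tuples_def)
  show "map (\<lambda>s. act ?E m s zs) ss \<in> Nbh ?E n"
    if n: "n \<ge> 1" and ss: "ss \<in> tuples (Ops \<O> m) n" and zs: "zs \<in> Nbh ?E m" for n m ss zs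
  proof -
    obtain i xs where i: "i \<in> I" "xs \<in> Nbh (B i) m" "zs = map (q i) xs"
      using zs by (rule glue_NbhE)
    interpret i_algebra \<O> "B i" using alg i by blast
    show ?thesis
      using glue_NbhI[OF i(1) neighbourhood[OF n ss i(2)]] by (simp only: map_act[OF i(1,2) ss] i(3))
  qed
  show "act ?E n \<sigma> (map (\<lambda>t. act ?E m t zs) ts) = act ?E m (sub \<O> n m \<sigma> ts) zs"
    if \<sigma>: "\<sigma> \<in> Ops \<O> n" and ts: "ts \<in> tuples (Ops \<O> m) n" and zs: "zs \<in> Nbh ?E m" for n m \<sigma> ts zs
  proof -
    obtain i xs where i: "i \<in> I" "xs \<in> Nbh (B i) m" "zs = map (q i) xs"
      using zs by (rule glue_NbhE)
    interpret i_algebra \<O> "B i" using alg i by blast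
    have "map (\<lambda>t. act (B i) m t xs) ts \<in> Nbh (B i) n"
    \<comment> \<open>The axiom \<open>neighbourhood\<close> starts at arity 1; for arity 0 the
      tuple is empty.\<close>
    proof (cases "n = 0")
      case True
      then show ?thesis using ts nbh_Nil by (auto simp: tuples_def)
    next
      case False
      then show ?thesis using neighbourhood[OF _ ts i(2)] by simp
    qed
    from glue_act[OF i(1) this \<sigma>] show ?thesis
      by (simp only: i(3) map_act[OF i(1,2) ts] associativity[OF \<sigma> ts i(2)]
          glue_act[OF i(1,2) is_clone.sub_closed[OF clone \<sigma> ts]])
  qed
  show "act ?E n (prj \<O> n j) zs = zs ! j" if "j < n" and zs: "zs \<in> Nbh ?E n" for j n zs
  proof -
    obtain i xs where i: "i \<in> I" "xs \<in> Nbh (B i) n" "zs = map (q i) xs"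
      using zs by (rule glue_NbhE)
    interpret i_algebra \<O> "B i" using alg i by blast
    show ?thesis using glue_act[OF i(1,2) is_clone.prj_closed[OF clone \<open>j < n\<close>]] projection[OF \<open>j < n\<close> i(2)] i(3)
        nbh_length[OF i(2)] \<open>j < n\<close>
      by simp
  qed
qed


lemma glue_hom:
  assumes "i \<in> I"
  shows "i_homomorphism \<O> (B i) (glue I B q) (restrict (q i) (carr (B i)))"
proof -
  interpret i_algebra \<O> "B i" using alg assms by blast
  have *: "map (restrict (q i) (carr (B i))) xs = map (q i) xs" if "xs \<in> Nbh (B i) n" for xs n
    using nbh_set[OF that] by auto
  show ?thesis
    using assms by (intro homI) (simp_all add: * glue_carrI glue_NbhI glue_act act_closed)
qed

text \<open>The hypothesis \<open>kernel\<close> makes the value attached to a class independent of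
  its representative. Neighbourhoods and operations of the quotient come from the summands, so the
  induced map is a homomorphism because each \<open>f i\<close> is.\<close>

lemma glue_universal:
  assumes f: "\<And>i. i \<in> I \<Longrightarrow> i_homomorphism \<O> (B i) X (f i)"
    and kernel: "\<And>i j x y. \<lbrakk>i \<in> I; j \<in> I; x \<in> carr (B i); y \<in> carr (B j); q i x = q j y\<rbrakk> \<Longrightarrow> f i x = f j y"
  obtains m where "i_homomorphism \<O> (glue I B q) X m"
    and "\<And>i x. i \<in> I \<Longrightarrow> x \<in> carr (B i) \<Longrightarrow> m (q i x) = f i x"
proof -
  define m where "m = (\<lambda>z\<in>carr (glue I B q). SOME y. \<exists>i\<in>I. \<exists>x\<in>carr (B i). z = q i x \<and> y = f i x)"
  have m: "m (q i x) = f i x" if "i \<in> I" "x \<in> carr (B i)" for i x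
  proof -
    have "(SOME y. \<exists>j\<in>I. \<exists>x'\<in>carr (B j). q i x = q j x' \<and> y = f j x') = f i x"
      by (rule some_equality) (use that kernel[OF that(1) _ that(2)] in metis)+
    then show ?thesis using that by (simp add: m_def glue_carrI)
  qed
  have map_m: "map m (map (q i) xs) = map (f i) xs" if "i \<in> I" "xs \<in> Nbh (B i) n" for i xs n
  proof -
    interpret i_algebra \<O> "B i" using alg that(1) .
    show ?thesis using nbh_set[OF that(2)] m[OF that(1)] by auto
  qed
  have "i_homomorphism \<O> (glue I B q) X m"
  proof (rule homI)
    show "m \<in> extensional (carr (glue I B q))" by (simp add: m_def)
    show "m z \<in> carr X" if z: "z \<in> carr (glue I B q)" for z
    proof -
      obtain i x where i: "i \<in> I" "x \<in> carr (B i)" "z = q i x" using z by (rule glue_carrE)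
      then show ?thesis using m[OF i(1,2)] hom_carr[OF f[OF i(1)] i(2)] by simp
    qed
    show "map m zs \<in> Nbh X n" if zs: "zs \<in> Nbh (glue I B q) n" for n zs
    proof -
      obtain i xs where i: "i \<in> I" "xs \<in> Nbh (B i) n" "zs = map (q i) xs" using zs by (rule glue_NbhE)
      show ?thesis using hom_nbh[OF f[OF i(1)] i(2)] by (simp only: i(3) map_m[OF i(1,2)])
    qed
    show "m (act (glue I B q) n \<sigma> zs) = act X n \<sigma> (map m zs)"
      if \<sigma>: "\<sigma> \<in> Ops \<O> n" and zs: "zs \<in> Nbh (glue I B q) n" for n \<sigma> zs
    proof -
      obtain i xs where i: "i \<in> I" "xs \<in> Nbh (B i) n" "zs = map (q i) xs" using zs by (rule glue_NbhE)
      interpret i_algebra \<O> "B i" using alg i(1) .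
      show ?thesis
        by (simp only: i(3) map_m[OF i(1,2)] glue_act[OF i(1,2) \<sigma>] m[OF i(1) act_closed[OF \<sigma> i(2)]]
            hom_act[OF f[OF i(1)] \<sigma> i(2)])
    qed
  qed
  then show thesis using that m by blast
qed

lemma glue_hom_eqI:
  assumes "i_homomorphism \<O> (glue I B q) X m" "i_homomorphism \<O> (glue I B q) X m'"
    and "\<And>i x. i \<in> I \<Longrightarrow> x \<in> carr (B i) \<Longrightarrow> m (q i x) = m' (q i x)"
  shows "m = m'"
  using assms by (intro hom_eqI[OF assms(1,2)]) (auto elim!: glue_carrE)

lemma glue_small:
  assumes "universe TYPE('u)" "small TYPE('u) I" "\<And>i. i \<in> I \<Longrightarrow> small TYPE('u) (carr (B i))"
  shows "small TYPE('u) (carr (glue I B q))"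
  unfolding glue_def using assms by (simp add: small_UN small_image)

end

section \<open>Presentations by generating neighbourhoods and relations\<close>

text \<open>The axiom \<open>unit\<close> covers only positive arities; \<open>normalisation\<close>
  is its case of arity 0, where the list of projections is empty.\<close>

lemma clone_unit:
  assumes "is_clone \<O>" "\<sigma> \<in> Ops \<O> n"
  shows "sub \<O> n n \<sigma> (map (prj \<O> n) [0..<n]) = \<sigma>"
proof -
  interpret is_clone \<O> by fact
  show ?thesis using assms unit normalisation by (cases "n = 0") simp_all
qed

text \<open>The i-algebra representing the functor that maps \<open>A\<close> to \<open>A\<langle>n\<rangle>\<close>.\<close>

definition free :: "'f clone \<Rightarrow> nat \<Rightarrow> ('f, 'f) ialg" where
  "free \<O> n = \<lparr>carr = Ops \<O> n, Nbh = tuples (Ops \<O> n), act = (\<lambda>k. sub \<O> k n)\<rparr>"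

lemma free_algebra:
  assumes "is_clone \<O>"
  shows "i_algebra \<O> (free \<O> n)"
proof -
  interpret is_clone \<O> by fact
  show ?thesis
  proof
    fix h :: "nat \<Rightarrow> nat" and m k xs
    assume "h \<in> {..<m} \<rightarrow> {..<k}" "xs \<in> Nbh (free \<O> n) k"
    then show "map (\<lambda>i. xs ! h i) [0..<m] \<in> Nbh (free \<O> n) m"
      by (auto simp: free_def tuples_def Pi_iff subset_iff)
  next
    fix k \<sigma> ts m xs
    assume "\<sigma> \<in> Ops \<O> k" "ts \<in> tuples (Ops \<O> m) k" "xs \<in> Nbh (free \<O> n) m"
    then show "act (free \<O> n) k \<sigma> (map (\<lambda>t. act (free \<O> n) m t xs) ts)
        = act (free \<O> n) m (sub \<O> k m \<sigma> ts) xs"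
      by (simp add: free_def associativity)
  next
    fix k ss m xs
    assume "ss \<in> tuples (Ops \<O> m) k" "xs \<in> Nbh (free \<O> n) m"
    then show "map (\<lambda>s. act (free \<O> n) m s xs) ss \<in> Nbh (free \<O> n) k"
      using sub_closed by (auto simp: free_def tuples_def)
  qed (auto simp: free_def sub_closed projection)
qed

text \<open>The Yoneda map: evaluation at \<open>ys\<close>, under which the tuple of all
  projections goes to \<open>ys\<close> itself. Associativity in \<open>B\<close> makes evaluation
  commute with substitution.\<close>

lemma free_hom:
  assumes "i_algebra \<O> B" "ys \<in> Nbh B n" "is_clone \<O>"
  shows "i_homomorphism \<O> (free \<O> n) B (\<lambda>\<sigma>\<in>Ops \<O> n. act B n \<sigma> ys)"
proof -
  interpret i_algebra \<O> B by fact
  have *: "map (\<lambda>\<sigma>\<in>Ops \<O> n. act B n \<sigma> ys) xs = map (\<lambda>\<sigma>. act B n \<sigma> ys) xs"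
    if "xs \<in> tuples (Ops \<O> n) k" for xs k
    using that by (auto simp: tuples_def)
  show ?thesis
  proof (rule homI)
    show "map (\<lambda>\<sigma>\<in>Ops \<O> n. act B n \<sigma> ys) xs \<in> Nbh B k" if "xs \<in> Nbh (free \<O> n) k" for k xs
    \<comment> \<open>Again arity 0 is outside the scope of the axiom
      \<open>neighbourhood\<close>.\<close>
    proof (cases "k = 0")
      case True
      then show ?thesis using that nbh_Nil by (simp add: free_def tuples_def)
    next
      case False
      have xs: "xs \<in> tuples (Ops \<O> n) k" using that by (simp add: free_def)
      show ?thesis using False neighbourhood[OF _ xs assms(2)] by (simp only: *[OF xs])
    qed
    show "(\<lambda>\<sigma>\<in>Ops \<O> n. act B n \<sigma> ys) (act (free \<O> n) k \<sigma> xs)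
        = act B k \<sigma> (map (\<lambda>\<sigma>\<in>Ops \<O> n. act B n \<sigma> ys) xs)"
      if \<sigma>: "\<sigma> \<in> Ops \<O> k" and "xs \<in> Nbh (free \<O> n) k" for k \<sigma> xs
    proof -
      have xs: "xs \<in> tuples (Ops \<O> n) k" using that by (simp add: free_def)
      show ?thesis
        unfolding *[OF xs] associativity[OF \<sigma> xs assms(2)]
        using is_clone.sub_closed[OF assms(3) \<sigma> xs] by (simp add: free_def)
    qed
  qed (simp_all add: free_def act_closed assms(2))
qed

text \<open>A relation equates two points of the disjoint union of the free algebras, each point
  being one operation on one generating neighbourhood. Composite terms over one generating
  neighbourhood collapse to this form by associativity, and entries of a neighbourhood are reached
  through projections.\<close>

definition satisfies ::
  "'p set \<Rightarrow> ('p \<Rightarrow> nat) \<Rightarrow> (('p \<times> 'f) \<times> ('p \<times> 'f)) set \<Rightarrow> ('f, 'a) ialg \<Rightarrow> ('p \<Rightarrow> 'a list) \<Rightarrow> bool" where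
  "satisfies N ar R B ys \<longleftrightarrow> (\<forall>p\<in>N. ys p \<in> Nbh B (ar p)) \<and>
     (\<forall>p \<sigma> p' \<tau>. ((p, \<sigma>), (p', \<tau>)) \<in> R \<longrightarrow> act B (ar p) \<sigma> (ys p) = act B (ar p') \<tau> (ys p'))"

text \<open>The tuples \<open>g p\<close> with \<open>p \<in> N\<close> are the generating neighbourhoods of \<open>K\<close>.\<close>

definition presents ::
  "'f clone \<Rightarrow> 'p set \<Rightarrow> ('p \<Rightarrow> nat) \<Rightarrow> (('p \<times> 'f) \<times> ('p \<times> 'f)) set
    \<Rightarrow> ('f, 'u) ialg \<Rightarrow> ('p \<Rightarrow> 'u list) \<Rightarrow> bool" where
  "presents \<O> N ar R K g \<longleftrightarrow> K \<in> Obj (iAlg \<O>) \<and> satisfies N ar R K g \<and>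
     (\<forall>B\<in>Obj (iAlg \<O> :: (('f, 'u) ialg, 'u \<Rightarrow> 'u) category). \<forall>ys. satisfies N ar R B ys \<longrightarrow>
       (\<exists>!h. i_homomorphism \<O> K B h \<and> (\<forall>p\<in>N. map h (g p) = ys p)))"

lemma presents_Obj: "presents \<O> N ar R K g \<Longrightarrow> K \<in> Obj (iAlg \<O>)"
  by (simp add: presents_def)

lemma presents_nbh: "presents \<O> N ar R K g \<Longrightarrow> p \<in> N \<Longrightarrow> g p \<in> Nbh K (ar p)"
  by (simp add: presents_def satisfies_def)

lemma presents_relation:
  "presents \<O> N ar R K g \<Longrightarrow> ((p, \<sigma>), (p', \<tau>)) \<in> R \<Longrightarrow> act K (ar p) \<sigma> (g p) = act K (ar p') \<tau> (g p')"
  by (simp add: presents_def satisfies_def)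

definition valid_relations ::
  "'f clone \<Rightarrow> 'p set \<Rightarrow> ('p \<Rightarrow> nat) \<Rightarrow> (('p \<times> 'f) \<times> ('p \<times> 'f)) set \<Rightarrow> bool" where
  "valid_relations \<O> N ar R \<longleftrightarrow> R \<subseteq> (SIGMA p:N. Ops \<O> (ar p)) \<times> (SIGMA p:N. Ops \<O> (ar p))"

lemma satisfies_hom:
  assumes "satisfies N ar R K g" "i_homomorphism \<O> K B h" "valid_relations \<O> N ar R"
  shows "satisfies N ar R B (\<lambda>p. map h (g p))"
proof -
  have "act B (ar p) \<sigma> (map h (g p)) = act B (ar p') \<tau> (map h (g p'))" if "((p, \<sigma>), (p', \<tau>)) \<in> R" for p \<sigma> p' \<tau>
  proof -
    have "p \<in> N" "p' \<in> N" "\<sigma> \<in> Ops \<O> (ar p)" "\<tau> \<in> Ops \<O> (ar p')"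
      using that assms(3) by (auto simp: valid_relations_def)
    then show ?thesis
      using that assms(1,2) by (simp add: satisfies_def flip: hom_act)
  qed
  then show ?thesis using assms(1,2) by (auto simp: satisfies_def hom_nbh)
qed

text \<open>The images of the generators under \<open>h\<close> again satisfy the relations, so the
  uniqueness clause applied to this family covers both \<open>h\<close> and
  \<open>h'\<close>.\<close>

lemma presents_hom_eqI:
  fixes K B :: "('f, 'u) ialg"
  assumes "presents \<O> N ar R K g" "B \<in> Obj (iAlg \<O>)" "valid_relations \<O> N ar R"
    and "i_homomorphism \<O> K B h" "i_homomorphism \<O> K B h'"
    and "\<And>p. p \<in> N \<Longrightarrow> map h (g p) = map h' (g p)"
  shows "h = h'"
proof -
  have "satisfies N ar R B (\<lambda>p. map h (g p))"
    using assms(1,3,4) satisfies_hom unfolding presents_def by blast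
  then have "\<exists>!h'. i_homomorphism \<O> K B h' \<and> (\<forall>p\<in>N. map h' (g p) = map h (g p))"
    using assms(1,2) unfolding presents_def by blast
  then show ?thesis using assms(4-6) by metis
qed

text \<open>Points of the disjoint union of free algebras are identified when all satisfying
  families in all small algebras evaluate them equally. A given satisfying family is one of these
  tests and therefore factors; uniqueness holds since each class is an operation applied to some
  \<open>g p\<close>.\<close>

lemma presentation_exists:
  fixes \<O> :: "'f clone" and N :: "'p set"
  assumes U: "universe TYPE('u)" and \<O>: "is_clone \<O>" "\<And>n. small TYPE('u) (Ops \<O> n)"
    and N: "N \<noteq> {}" "small TYPE('u) N"
    and R: "valid_relations \<O> N ar R"
  obtains K :: "('f, 'u) ialg" and g where "presents \<O> N ar R K g"
proof -
  define T where "T = (SIGMA p:N. Ops \<O> (ar p))"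
  have T: "small TYPE('u) T"
    unfolding T_def by (intro small_Sigma U N \<O>)
  \<comment> \<open>A point is sent to the function of all its evaluations. The value
    \<open>None\<close> makes pairs that are not tests irrelevant to the kernel.\<close>
  define k where "k = (\<lambda>(p, \<sigma>) (B :: ('f, 'u) ialg) ys.
    if B \<in> Obj (iAlg \<O>) \<and> satisfies N ar R B ys then Some (act B (ar p) \<sigma> (ys p)) else None)"
  obtain q :: "'p \<times> 'f \<Rightarrow> 'u" where q: "\<And>s t. s \<in> T \<Longrightarrow> t \<in> T \<Longrightarrow> q s = q t \<longleftrightarrow> k s = k t"
    using small_kernel[OF T, of k] by metis
  have q': "q (p, \<sigma>) = q (p', \<tau>) \<longleftrightarrow>
      (\<forall>(B :: ('f, 'u) ialg) ys. B \<in> Obj (iAlg \<O>) \<and> satisfies N ar R B ys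
        \<longrightarrow> act B (ar p) \<sigma> (ys p) = act B (ar p') \<tau> (ys p'))"
    if "p \<in> N" "\<sigma> \<in> Ops \<O> (ar p)" "p' \<in> N" "\<tau> \<in> Ops \<O> (ar p')" for p \<sigma> p' \<tau>
  proof -
    have "(p, \<sigma>) \<in> T" "(p', \<tau>) \<in> T" using that by (auto simp: T_def)
    moreover have "(if P then Some a else None) = (if P then Some b else None) \<longleftrightarrow> (P \<longrightarrow> a = b)"
      for P and a b :: 'u by simp
    ultimately show ?thesis by (simp only: q k_def case_prod_conv fun_eq_iff)
  qed
  interpret glueing \<O> N "\<lambda>p. free \<O> (ar p)" "\<lambda>p \<sigma>. q (p, \<sigma>)"
  proof (rule glueing.intro)
    fix p p' \<sigma> n xs ys
    assume p: "p \<in> N" "p' \<in> N" and \<sigma>: "\<sigma> \<in> Ops \<O> n"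
      and xy: "xs \<in> Nbh (free \<O> (ar p)) n" "ys \<in> Nbh (free \<O> (ar p')) n"
      and eq: "map (\<lambda>\<sigma>. q (p, \<sigma>)) xs = map (\<lambda>\<sigma>. q (p', \<sigma>)) ys"
    have xs: "xs \<in> tuples (Ops \<O> (ar p)) n" and ys: "ys \<in> tuples (Ops \<O> (ar p')) n"
      using xy by (simp_all add: free_def)
    \<comment> \<open>For each test, evaluating a substitution is applying \<sigma> to the evaluated
      tuple, and the two evaluated tuples agree entry by entry.\<close>
    have "act B (ar p) (sub \<O> n (ar p) \<sigma> xs) (zs p) = act B (ar p') (sub \<O> n (ar p') \<sigma> ys) (zs p')"
      if B: "B \<in> Obj (iAlg \<O>)" "satisfies N ar R B zs" for B :: "('f, 'u) ialg" and zs
    proof -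
      interpret i_algebra \<O> B using B by (simp add: iAlg_Obj)
      have z: "zs p \<in> Nbh B (ar p)" "zs p' \<in> Nbh B (ar p')"
        using B(2) p by (auto simp: satisfies_def)
      have "map (\<lambda>t. act B (ar p) t (zs p)) xs = map (\<lambda>t. act B (ar p') t (zs p')) ys"
        using eq
      proof (rule map_eq_map)
        fix t t' assume "t \<in> set xs" "t' \<in> set ys" "q (p, t) = q (p', t')"
        moreover have "set xs \<subseteq> Ops \<O> (ar p)" "set ys \<subseteq> Ops \<O> (ar p')"
          using xs ys by (simp_all add: tuples_def)
        ultimately show "act B (ar p) t (zs p) = act B (ar p') t' (zs p')"
          using q' p B by blast
      qed
      then show ?thesis
        using associativity[OF \<sigma> xs z(1)] associativity[OF \<sigma> ys z(2)] by simp
    qed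
    moreover have "sub \<O> n (ar p) \<sigma> xs \<in> Ops \<O> (ar p)" "sub \<O> n (ar p') \<sigma> ys \<in> Ops \<O> (ar p')"
      using is_clone.sub_closed[OF \<O>(1) \<sigma>] xs ys by blast+
    ultimately show "q (p, act (free \<O> (ar p)) n \<sigma> xs) = q (p', act (free \<O> (ar p')) n \<sigma> ys)"
      using p by (simp add: free_def q')
  qed (simp_all add: \<O> N free_algebra)
  let ?K = "glue N (\<lambda>p. free \<O> (ar p)) (\<lambda>p \<sigma>. q (p, \<sigma>))"
  \<comment> \<open>The tuple of projections is the universal neighbourhood of the free algebra; its
    image in the quotient is the generator \<open>g p\<close>.\<close>
  define e where "e p = map (prj \<O> (ar p)) [0..<ar p]" for p
  have e: "e p \<in> Nbh (free \<O> (ar p)) (ar p)" for p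
    using is_clone.prj_closed[OF \<O>(1)] by (auto simp: free_def tuples_def e_def)
  define g where "g p = map (\<lambda>\<sigma>. q (p, \<sigma>)) (e p)" for p
  \<comment> \<open>By the unit law the class of \<sigma> is \<sigma> applied to \<open>g p\<close>,
    so the generators reach every point.\<close>
  have act_g: "act ?K (ar p) \<sigma> (g p) = q (p, \<sigma>)" if "p \<in> N" "\<sigma> \<in> Ops \<O> (ar p)" for p \<sigma>
    using glue_act[OF that(1) e that(2)] clone_unit[OF \<O>(1) that(2)] unfolding g_def
    by (simp add: free_def e_def)
  have K: "?K \<in> Obj (iAlg \<O>)"
    using glue_algebra glue_small[OF U N(2)] \<O>(2) by (simp add: iAlg_Obj free_def)
  have g: "satisfies N ar R ?K g"
    unfolding satisfies_def
  proof (intro conjI ballI allI impI)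
    show "g p \<in> Nbh ?K (ar p)" if "p \<in> N" for p
      unfolding g_def by (rule glue_NbhI[OF that e])
    fix p \<sigma> p' \<tau> assume r: "((p, \<sigma>), (p', \<tau>)) \<in> R"
    then have "p \<in> N" "p' \<in> N" "\<sigma> \<in> Ops \<O> (ar p)" "\<tau> \<in> Ops \<O> (ar p')"
      using R by (auto simp: valid_relations_def)
    then show "act ?K (ar p) \<sigma> (g p) = act ?K (ar p') \<tau> (g p')"
      using r by (simp add: act_g q' satisfies_def)
  qed
  have "\<exists>!h. i_homomorphism \<O> ?K B h \<and> (\<forall>p\<in>N. map h (g p) = ys p)"
    if B: "B \<in> Obj (iAlg \<O>)" and ys: "satisfies N ar R B ys" for B :: "('f, 'u) ialg" and ys
  proof -
    interpret B: i_algebra \<O> B using B by (simp add: iAlg_Obj)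
    have ys_nbh: "ys p \<in> Nbh B (ar p)" if "p \<in> N" for p
      using ys that by (simp add: satisfies_def)
    obtain m where m: "i_homomorphism \<O> ?K B m"
      and m_q: "\<And>p \<sigma>. p \<in> N \<Longrightarrow> \<sigma> \<in> carr (free \<O> (ar p))
        \<Longrightarrow> m (q (p, \<sigma>)) = (\<lambda>\<sigma>\<in>Ops \<O> (ar p). act B (ar p) \<sigma> (ys p)) \<sigma>"
    proof (rule glue_universal)
      show "i_homomorphism \<O> (free \<O> (ar p)) B (\<lambda>\<sigma>\<in>Ops \<O> (ar p). act B (ar p) \<sigma> (ys p))"
        if "p \<in> N" for p
        by (rule free_hom[OF B.i_algebra_axioms ys_nbh[OF that] \<O>(1)])
    qed (use B ys in \<open>auto simp: free_def q'\<close>)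
    have "map m (g p) = ys p" if p: "p \<in> N" for p
    proof -
      have "map m (g p) = map (\<lambda>j. act B (ar p) (prj \<O> (ar p) j) (ys p)) [0..<ar p]"
        using is_clone.prj_closed[OF \<O>(1)] p by (simp add: g_def e_def m_q free_def)
      also have "\<dots> = map (\<lambda>j. ys p ! j) [0..<ar p]"
        using B.projection[OF _ ys_nbh[OF p]] by simp
      also have "\<dots> = ys p"
        using B.nbh_length[OF ys_nbh[OF p]] map_nth by metis
      finally show ?thesis .
    qed
    moreover have "h = h'" if h: "i_homomorphism \<O> ?K B h" "i_homomorphism \<O> ?K B h'"
      and "\<forall>p\<in>N. map h (g p) = ys p" "\<forall>p\<in>N. map h' (g p) = ys p" for h h'
    proof (rule glue_hom_eqI[OF h])
      fix p \<sigma> assume p: "p \<in> N" and "\<sigma> \<in> carr (free \<O> (ar p))"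
      then have \<sigma>: "\<sigma> \<in> Ops \<O> (ar p)" by (simp add: free_def)
      have gp: "g p \<in> Nbh ?K (ar p)" using g p by (simp add: satisfies_def)
      show "h (q (p, \<sigma>)) = h' (q (p, \<sigma>))"
        using hom_act[OF h(1) \<sigma> gp] hom_act[OF h(2) \<sigma> gp] that(3,4) p \<sigma> by (simp add: act_g)
    qed
    ultimately show ?thesis using m by (intro ex1I[of _ m]) auto
  qed
  then have "presents \<O> N ar R ?K g"
    using K g by (simp add: presents_def)
  then show thesis by (rule that)
qed

section \<open>Colimits\<close>

locale diagram = J: is_category J + is_functor J "iAlg \<O> :: (('f, 'u) ialg, 'u \<Rightarrow> 'u) category" D Da
  for \<O> :: "'f clone" and J :: "('u, 'u) category" and D Da +
  assumes U: "universe TYPE('u)" and clone: "is_clone \<O>" and small_J: "small_category J"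
begin

abbreviation "C \<equiv> iAlg \<O> :: (('f, 'u) ialg, 'u \<Rightarrow> 'u) category"

lemma D_algebra: "i \<in> Obj J \<Longrightarrow> i_algebra \<O> (D i)"
  using obj_closed by (simp add: iAlg_Obj)

lemma Da_hom: "\<lbrakk>i \<in> Obj J; j \<in> Obj J; u \<in> Hom J i j\<rbrakk> \<Longrightarrow> i_homomorphism \<O> (D i) (D j) (Da i j u)"
  using arr_closed by (simp add: iAlg_Hom)

lemma small_points: "small TYPE('u) (SIGMA i:Obj J. carr (D i))"
  using small_J obj_closed by (intro small_Sigma[OF U]) (auto simp: small_category_def iAlg_Obj)

lemma cocone_Obj: "is_cocone J C D Da c l \<Longrightarrow> c \<in> Obj C"
  by (simp add: is_cocone_def)

lemma cocone_hom: "is_cocone J C D Da c l \<Longrightarrow> i \<in> Obj J \<Longrightarrow> i_homomorphism \<O> (D i) c (l i)"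
  by (simp add: is_cocone_def iAlg_Hom)

lemma cocone_Da:
  assumes "is_cocone J C D Da c l" "i \<in> Obj J" "j \<in> Obj J" "u \<in> Hom J i j" "x \<in> carr (D i)"
  shows "l j (Da i j u x) = l i x"
proof -
  have "compose (carr (D i)) (l j) (Da i j u) = l i"
    using assms(1-4) by (simp add: is_cocone_def iAlg_Cmp)
  from fun_cong[OF this, of x] show ?thesis using assms(5) by (simp add: compose_eq)
qed

lemma coconeI:
  assumes "c \<in> Obj C" "\<And>i. i \<in> Obj J \<Longrightarrow> i_homomorphism \<O> (D i) c (l i)"
    and "\<And>i j u x. \<lbrakk>i \<in> Obj J; j \<in> Obj J; u \<in> Hom J i j; x \<in> carr (D i)\<rbrakk> \<Longrightarrow> l j (Da i j u x) = l i x"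
  shows "is_cocone J C D Da c l"
  unfolding is_cocone_def
proof (intro conjI ballI)
  fix i j u assume i: "i \<in> Obj J" "j \<in> Obj J" "u \<in> Hom J i j"
  show "Cmp C (D i) (D j) c (l j) (Da i j u) = l i"
    unfolding iAlg_Cmp
    by (rule extensionalityI[of _ "carr (D i)"])
      (use i assms in \<open>auto simp: compose_eq intro: hom_extensional\<close>)
qed (use assms in \<open>auto simp: iAlg_Hom\<close>)

lemma Cmp_eqI:
  assumes "i_homomorphism \<O> A X h" "\<And>x. x \<in> carr A \<Longrightarrow> m (f x) = h x"
  shows "Cmp C A B X m f = h"
  unfolding iAlg_Cmp
  by (rule extensionalityI[of _ "carr A"]) (use assms in \<open>auto simp: compose_eq intro: hom_extensional\<close>)

lemma Cmp_eqD: "Cmp C A B X m f = h \<Longrightarrow> x \<in> carr A \<Longrightarrow> m (f x) = h x"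
  by (auto simp: iAlg_Cmp compose_eq)

lemma colimit_factor:
  assumes "is_colimit J C D Da c l" "is_cocone J C D Da c' l'"
  obtains m where "i_homomorphism \<O> c c' m"
    and "\<And>i x. i \<in> Obj J \<Longrightarrow> x \<in> carr (D i) \<Longrightarrow> m (l i x) = l' i x"
proof -
  have "\<exists>!m. m \<in> Hom C c c' \<and> (\<forall>i\<in>Obj J. Cmp C (D i) c c' m (l i) = l' i)"
    using assms by (simp add: is_colimit_def)
  then obtain m where m: "m \<in> Hom C c c'" "\<forall>i\<in>Obj J. Cmp C (D i) c c' m (l i) = l' i"
    by (auto dest: ex1_implies_ex)
  show thesis
  proof (rule that)
    show "i_homomorphism \<O> c c' m" using m(1) by (simp add: iAlg_Hom)
    show "m (l i x) = l' i x" if "i \<in> Obj J" "x \<in> carr (D i)" for i x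
      using Cmp_eqD[OF m(2)[rule_format, OF that(1)] that(2)] .
  qed
qed

text \<open>Composing \<open>m\<close> with the legs gives a cocone through which both maps
  factor.\<close>

lemma colimit_hom_eqI:
  assumes "is_colimit J C D Da c l" "c' \<in> Obj C"
    and m: "i_homomorphism \<O> c c' m" "i_homomorphism \<O> c c' m'"
    and eq: "\<And>i x. i \<in> Obj J \<Longrightarrow> x \<in> carr (D i) \<Longrightarrow> m (l i x) = m' (l i x)"
  shows "m = m'"
proof -
  have c: "is_cocone J C D Da c l" using assms(1) by (simp add: is_colimit_def)
  define l' where "l' i = compose (carr (D i)) m (l i)" for i
  have l': "i_homomorphism \<O> (D i) c' (l' i)" if "i \<in> Obj J" for i
    unfolding l'_def by (rule hom_compose[OF D_algebra[OF that] cocone_hom[OF c that] m(1)])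
  have "is_cocone J C D Da c' l'"
    using assms(2) l'
  proof (rule coconeI)
    fix i j u x assume i: "i \<in> Obj J" "j \<in> Obj J" "u \<in> Hom J i j" and x: "x \<in> carr (D i)"
    show "l' j (Da i j u x) = l' i x"
      using hom_carr[OF Da_hom[OF i] x] x cocone_Da[OF c i x] by (simp add: l'_def compose_eq)
  qed
  then have ex1: "\<exists>!m. m \<in> Hom C c c' \<and> (\<forall>i\<in>Obj J. Cmp C (D i) c c' m (l i) = l' i)"
    using assms(1) by (simp add: is_colimit_def)
  have *: "Cmp C (D i) c c' m (l i) = l' i" "Cmp C (D i) c c' m' (l i) = l' i" if "i \<in> Obj J" for i
    by (rule Cmp_eqI[OF l'[OF that]]; use that in \<open>simp add: l'_def compose_eq eq\<close>)+
  have "m \<in> Hom C c c' \<and> (\<forall>i\<in>Obj J. Cmp C (D i) c c' m (l i) = l' i)"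
    "m' \<in> Hom C c c' \<and> (\<forall>i\<in>Obj J. Cmp C (D i) c c' m' (l i) = l' i)"
    using m * by (simp_all add: iAlg_Hom)
  with ex1 show ?thesis by blast
qed

text \<open>The hypotheses bound the identifications from both sides: \<open>q\<close> identifies
  enough to be a cocone, and nothing beyond what every cocone identifies.\<close>

lemma glue_colimit:
  assumes "glueing \<O> (Obj J) D q"
    and Da: "\<And>i j u x. \<lbrakk>i \<in> Obj J; j \<in> Obj J; u \<in> Hom J i j; x \<in> carr (D i)\<rbrakk> \<Longrightarrow> q j (Da i j u x) = q i x"
    and kernel: "\<And>i j x y c l. \<lbrakk>is_cocone J C D Da c l; i \<in> Obj J; j \<in> Obj J; x \<in> carr (D i); y \<in> carr (D j);
      q i x = q j y\<rbrakk> \<Longrightarrow> l i x = l j y"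
  shows "is_colimit J C D Da (glue (Obj J) D q) (\<lambda>i. restrict (q i) (carr (D i)))"
proof -
  interpret glueing \<O> "Obj J" D q by fact
  let ?E = "glue (Obj J) D q" and ?l = "\<lambda>i. restrict (q i) (carr (D i))"
  have "?E \<in> Obj C"
    using glue_algebra glue_small[OF U] small_J obj_closed by (simp add: iAlg_Obj small_category_def)
  then have "is_cocone J C D Da ?E ?l"
    by (rule coconeI) (use glue_hom Da hom_carr[OF Da_hom] in auto)
  moreover have "\<exists>!m. m \<in> Hom C ?E c \<and> (\<forall>i\<in>Obj J. Cmp C (D i) ?E c m (?l i) = l i)"
    if c: "is_cocone J C D Da c l" for c l
  proof -
    obtain m where m: "i_homomorphism \<O> ?E c m" "\<And>i x. i \<in> Obj J \<Longrightarrow> x \<in> carr (D i) \<Longrightarrow> m (q i x) = l i x"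
    proof (rule glue_universal)
      show "i_homomorphism \<O> (D i) c (l i)" if "i \<in> Obj J" for i
        by (rule cocone_hom[OF c that])
      show "l i x = l j y"
        if "i \<in> Obj J" "j \<in> Obj J" "x \<in> carr (D i)" "y \<in> carr (D j)" "q i x = q j y" for i j x y
        by (rule kernel[OF c that])
    qed (erule that, simp)
    show ?thesis
    proof (rule ex1I[of _ m])
      show "m \<in> Hom C ?E c \<and> (\<forall>i\<in>Obj J. Cmp C (D i) ?E c m (?l i) = l i)"
        using m by (auto simp: iAlg_Hom intro!: Cmp_eqI cocone_hom[OF c])
    next
      fix m' assume m': "m' \<in> Hom C ?E c \<and> (\<forall>i\<in>Obj J. Cmp C (D i) ?E c m' (?l i) = l i)"
      have "m' (q i x) = l i x" if "i \<in> Obj J" "x \<in> carr (D i)" for i x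
      proof -
        have "compose (carr (D i)) m' (?l i) x = l i x"
          using m' that(1) by (simp add: iAlg_Cmp)
        then show ?thesis using that(2) by (simp add: compose_eq)
      qed
      then show "m' = m"
        using m m' by (intro glue_hom_eqI) (simp_all add: iAlg_Hom)
    qed
  qed
  ultimately show ?thesis unfolding is_colimit_def by blast
qed

text \<open>For a nonempty shape, points are identified when every cocone identifies them. The empty
  shape has no summand to glue, so the initial algebra is obtained from a presentation
  instead.\<close>

lemma colimit_exists:
  assumes "\<And>n. small TYPE('u) (Ops \<O> n)"
  obtains c l where "is_colimit J C D Da c l"
proof (cases "Obj J = {}")
  case True
  \<comment> \<open>One generating neighbourhood of arity 0 and no relations: the generator can only
    go to the empty tuple, so the presented algebra is initial.\<close>
  obtain K :: "('f, 'u) ialg" and g where K: "presents \<O> {()} (\<lambda>_. 0) {} K g"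
    by (rule presentation_exists[OF U clone assms, of "{()}" "\<lambda>_. 0" "{}"])
      (auto simp: small_finite[OF U] valid_relations_def)
  have "\<exists>!m. m \<in> Hom C K c" if c: "c \<in> Obj C" for c
  proof -
    interpret K: i_algebra \<O> K using presents_Obj[OF K] by (simp add: iAlg_Obj)
    interpret c: i_algebra \<O> c using c by (simp add: iAlg_Obj)
    have "g () = []" using presents_nbh[OF K, of "()"] K.nbh_Nil by simp
    moreover have "satisfies {()} (\<lambda>_. 0) {} c (\<lambda>_. [])"
      by (simp add: satisfies_def c.nbh_Nil)
    ultimately show ?thesis
      using K c unfolding presents_def iAlg_Hom by fastforce
  qed
  then have "is_colimit J C D Da K l" for l
    using True presents_Obj[OF K] by (simp add: is_colimit_def is_cocone_def)
  then show thesis by (rule that)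
next
  case False
  define k where "k = (\<lambda>(i, x) c l. if is_cocone J C D Da c l then Some (l i x) else None)"
  obtain q' :: "'u \<times> 'u \<Rightarrow> 'u" where q': "\<And>s t. \<lbrakk>s \<in> (SIGMA i:Obj J. carr (D i)); t \<in> (SIGMA i:Obj J. carr (D i))\<rbrakk>
      \<Longrightarrow> q' s = q' t \<longleftrightarrow> k s = k t"
    using small_kernel[OF small_points, of k] by metis
  define q where "q i x = q' (i, x)" for i x
  have q: "q i x = q j y \<longleftrightarrow> (\<forall>c l. is_cocone J C D Da c l \<longrightarrow> l i x = l j y)"
    if "i \<in> Obj J" "j \<in> Obj J" "x \<in> carr (D i)" "y \<in> carr (D j)" for i j x y
  proof -
    have "(i, x) \<in> (SIGMA i:Obj J. carr (D i))" "(j, y) \<in> (SIGMA i:Obj J. carr (D i))"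
      using that by auto
    moreover have "(if P then Some a else None) = (if P then Some b else None) \<longleftrightarrow> (P \<longrightarrow> a = b)"
      for P and a b :: 'u by simp
    ultimately show ?thesis by (simp only: q_def q' k_def case_prod_conv fun_eq_iff)
  qed
  have "glueing \<O> (Obj J) D q"
  proof (rule glueing.intro)
    fix i j \<sigma> n xs ys
    assume i: "i \<in> Obj J" and j: "j \<in> Obj J" and \<sigma>: "\<sigma> \<in> Ops \<O> n"
      and xs: "xs \<in> Nbh (D i) n" and ys: "ys \<in> Nbh (D j) n" and eq: "map (q i) xs = map (q j) ys"
    interpret Di: i_algebra \<O> "D i" by (rule D_algebra[OF i])
    interpret Dj: i_algebra \<O> "D j" by (rule D_algebra[OF j])
    have "l i (act (D i) n \<sigma> xs) = l j (act (D j) n \<sigma> ys)" if c: "is_cocone J C D Da c l" for c l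
    proof -
      have "map (l i) xs = map (l j) ys"
        using eq
      proof (rule map_eq_map)
        fix x y assume "x \<in> set xs" "y \<in> set ys" "q i x = q j y"
        then show "l i x = l j y"
          using q[OF i j] c Di.nbh_set[OF xs] Dj.nbh_set[OF ys] by blast
      qed
      then show ?thesis
        using hom_act[OF cocone_hom[OF c i] \<sigma> xs] hom_act[OF cocone_hom[OF c j] \<sigma> ys] by simp
    qed
    then show "q i (act (D i) n \<sigma> xs) = q j (act (D j) n \<sigma> ys)"
      using q[OF i j Di.act_closed[OF \<sigma> xs] Dj.act_closed[OF \<sigma> ys]] by blast
  qed (use clone False D_algebra in simp_all)
  then have "is_colimit J C D Da (glue (Obj J) D q) (\<lambda>i. restrict (q i) (carr (D i)))"
  proof (rule glue_colimit)
    show "q j (Da i j u x) = q i x"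
      if "i \<in> Obj J" "j \<in> Obj J" "u \<in> Hom J i j" "x \<in> carr (D i)" for i j u x
      using q[OF that(2,1) hom_carr[OF Da_hom[OF that(1-3)] that(4)] that(4)] cocone_Da[OF _ that]
      by blast
  qed (use q in blast)
  then show thesis by (rule that)
qed

end

lemma iAlg_cocomplete:
  fixes \<O> :: "'f clone"
  assumes "universe TYPE('u)" "is_clone \<O>" "\<And>n. small TYPE('u) (Ops \<O> n)"
  shows "cocomplete TYPE('u) (iAlg \<O> :: (('f, 'u) ialg, 'u \<Rightarrow> 'u) category)"
  unfolding cocomplete_def
proof (intro allI impI)
  fix J :: "('u, 'u) category" and D Da
  assume "small_category J \<and> is_functor J (iAlg \<O> :: (('f, 'u) ialg, 'u \<Rightarrow> 'u) category) D Da"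
  then interpret diagram \<O> J D Da
    using assms by (simp add: diagram_def diagram_axioms_def small_category_def)
  show "\<exists>c l. is_colimit J C D Da c l" using colimit_exists[OF assms(3)] by blast
qed


section \<open>Directed colimits\<close>

locale directed_diagram = diagram \<O> J D Da
  for \<O> :: "'f clone" and J :: "('u, 'u) category" and D Da +
  assumes directed: "directed_poset J"
begin

definition le where "le i j \<longleftrightarrow> Hom J i j \<noteq> {}"

text \<open>In a poset a hom-set has at most one arrow, so the choice is no choice and arrows can be
  replaced by the relation \<open>le\<close>.\<close>

definition t where "t i j = Da i j (SOME u. u \<in> Hom J i j)"

lemma Da_eq_t: "\<lbrakk>i \<in> Obj J; j \<in> Obj J; u \<in> Hom J i j\<rbrakk> \<Longrightarrow> Da i j u = t i j"
  using directed someI[of "\<lambda>u. u \<in> Hom J i j" u] unfolding t_def directed_poset_def by metis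

lemma le_refl: "i \<in> Obj J \<Longrightarrow> le i i"
  using J.idn_closed unfolding le_def by blast

lemma le_trans: "\<lbrakk>i \<in> Obj J; j \<in> Obj J; k \<in> Obj J; le i j; le j k\<rbrakk> \<Longrightarrow> le i k"
  using J.cmp_closed unfolding le_def by blast

lemma t_hom: "\<lbrakk>i \<in> Obj J; j \<in> Obj J; le i j\<rbrakk> \<Longrightarrow> i_homomorphism \<O> (D i) (D j) (t i j)"
  using Da_hom Da_eq_t unfolding le_def by (metis ex_in_conv)

lemma t_t:
  assumes "i \<in> Obj J" "j \<in> Obj J" "k \<in> Obj J" "le i j" "le j k" "x \<in> carr (D i)"
  shows "t j k (t i j x) = t i k x"
proof -
  obtain u v where u: "u \<in> Hom J i j" "v \<in> Hom J j k" using assms(4,5) by (auto simp: le_def)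
  have "t i k = compose (carr (D i)) (t j k) (t i j)"
    using pres_cmp[OF assms(1-3) u] J.cmp_closed[OF assms(1-3) u] u assms(1-3)
    by (simp add: Da_eq_t iAlg_Cmp)
  then show ?thesis using assms(6) by (simp add: compose_eq)
qed

lemma le_directed: "\<lbrakk>i \<in> Obj J; j \<in> Obj J\<rbrakk> \<Longrightarrow> \<exists>k\<in>Obj J. le i k \<and> le j k"
  using directed by (simp add: directed_poset_def le_def)

lemma upper_bound:
  assumes "finite F" "F \<subseteq> Obj J"
  obtains k where "k \<in> Obj J" "\<And>i. i \<in> F \<Longrightarrow> le i k"
proof -
  have "\<exists>k\<in>Obj J. \<forall>i\<in>F. le i k"
    using assms
  proof (induction F rule: finite_induct)
    case empty
    then show ?case using directed by (auto simp: directed_poset_def)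
  next
    case (insert i F)
    then obtain k where k: "k \<in> Obj J" "\<forall>i\<in>F. le i k" by auto
    obtain k' where "k' \<in> Obj J" "le i k'" "le k k'"
      using le_directed[of i k] insert.prems k(1) by auto
    then show ?case using k insert.prems le_trans[of _ k k'] by (intro bexI[of _ k']) auto
  qed
  then show thesis using that by blast
qed

definition eventually_eq where
  "eventually_eq i x j y \<longleftrightarrow> (\<exists>k\<in>Obj J. le i k \<and> le j k \<and> t i k x = t j k y)"

lemma eventually_eq_mono:
  assumes "i \<in> Obj J" "j \<in> Obj J" "k \<in> Obj J" "k' \<in> Obj J" "le i k" "le j k" "le k k'"
    and "x \<in> carr (D i)" "y \<in> carr (D j)" "t i k x = t j k y"
  shows "t i k' x = t j k' y"
  using t_t[of i k k' x] t_t[of j k k' y] assms by simp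

lemma eventually_eq_trans:
  assumes "i \<in> Obj J" "i' \<in> Obj J" "i'' \<in> Obj J" "x \<in> carr (D i)" "x' \<in> carr (D i')" "x'' \<in> carr (D i'')"
    and "eventually_eq i x i' x'" "eventually_eq i' x' i'' x''"
  shows "eventually_eq i x i'' x''"
proof -
  obtain k k' where k: "k \<in> Obj J" "le i k" "le i' k" "t i k x = t i' k x'"
    "k' \<in> Obj J" "le i' k'" "le i'' k'" "t i' k' x' = t i'' k' x''"
    using assms(7,8) by (auto simp: eventually_eq_def)
  obtain m where m: "m \<in> Obj J" "le k m" "le k' m"
    by (rule upper_bound[of "{k, k'}"]) (use k in auto)
  have "t i m x = t i' m x'" "t i' m x' = t i'' m x''"
    using assms k m by (auto intro: eventually_eq_mono[of _ _ k m] eventually_eq_mono[of _ _ k' m])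
  moreover have "le i m" "le i'' m"
    using assms k m le_trans by blast+
  ultimately show ?thesis using m(1) by (auto simp: eventually_eq_def)
qed

text \<open>Finitely many witnessing stages have an upper bound, which can be taken above
  \<open>F\<close> as well, and equalities persist to later stages. Every later use of finiteness
  (of tuples, generators and relations) goes through this lemma.\<close>

lemma eventually_eq_finite:
  assumes i: "finite P" and "\<And>i x j y. (i, x, j, y) \<in> P \<Longrightarrow> i \<in> Obj J \<and> j \<in> Obj J
      \<and> x \<in> carr (D i) \<and> y \<in> carr (D j) \<and> eventually_eq i x j y"
    and F: "finite F" "F \<subseteq> Obj J"
  obtains k where "k \<in> Obj J" "\<forall>i\<in>F. le i k"
    "\<forall>i x j y. (i, x, j, y) \<in> P \<longrightarrow> le i k \<and> le j k \<and> t i k x = t j k y"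
proof -
  have "\<forall>p\<in>P. \<exists>k. case p of (i, x, j, y) \<Rightarrow> k \<in> Obj J \<and> le i k \<and> le j k \<and> t i k x = t j k y"
    using assms(2) unfolding eventually_eq_def by fast
  then obtain K where K: "\<forall>p\<in>P. case p of (i, x, j, y) \<Rightarrow> K p \<in> Obj J \<and> le i (K p) \<and> le j (K p)
      \<and> t i (K p) x = t j (K p) y"
    using bchoice by meson
  obtain k where k: "k \<in> Obj J" "\<And>i. i \<in> F \<union> K ` P \<Longrightarrow> le i k"
  proof (rule upper_bound[of "F \<union> K ` P"])
    show "F \<union> K ` P \<subseteq> Obj J" using F K by fast
  qed (use assms in auto)
  have "le i k \<and> le j k \<and> t i k x = t j k y" if p: "(i, x, j, y) \<in> P" for i x j y
  proof -
    let ?k = "K (i, x, j, y)"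
    have *: "?k \<in> Obj J" "le i ?k" "le j ?k" "t i ?k x = t j ?k y" "le ?k k"
      using K k p by auto
    then show ?thesis
      using assms(2)[OF p] k(1) le_trans[of _ ?k k] eventually_eq_mono[of i j ?k k x y] by blast
  qed
  then show thesis using k by (intro that[of k]) simp_all
qed

text \<open>Tuples are finite, so entrywise eventual equality becomes equality of the whole tuples
  at one stage, where a transition homomorphism can be applied.\<close>

lemma eventually_eq_act:
  assumes i: "i \<in> Obj J" and j: "j \<in> Obj J" and \<sigma>: "\<sigma> \<in> Ops \<O> n"
    and xs: "xs \<in> Nbh (D i) n" and ys: "ys \<in> Nbh (D j) n"
    and eq: "\<And>a. a < n \<Longrightarrow> eventually_eq i (xs ! a) j (ys ! a)"
  shows "eventually_eq i (act (D i) n \<sigma> xs) j (act (D j) n \<sigma> ys)"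
proof -
  interpret Di: i_algebra \<O> "D i" by (rule D_algebra[OF i])
  interpret Dj: i_algebra \<O> "D j" by (rule D_algebra[OF j])
  obtain k where k: "k \<in> Obj J" "\<forall>i'\<in>{i, j}. le i' k"
    "\<forall>i' x j' y. (i', x, j', y) \<in> (\<lambda>a. (i, xs ! a, j, ys ! a)) ` {..<n} \<longrightarrow>
      le i' k \<and> le j' k \<and> t i' k x = t j' k y"
    by (rule eventually_eq_finite[of "(\<lambda>a. (i, xs ! a, j, ys ! a)) ` {..<n}" "{i, j}"])
      (use i j eq Di.nbh_nth[OF xs] Dj.nbh_nth[OF ys] in auto)
  have "map (t i k) xs = map (t j k) ys"
    using k(3) Di.nbh_length[OF xs] Dj.nbh_length[OF ys] by (intro nth_equalityI) auto
  then have "t i k (act (D i) n \<sigma> xs) = t j k (act (D j) n \<sigma> ys)"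
    using hom_act[OF t_hom[OF i k(1)] \<sigma> xs] hom_act[OF t_hom[OF j k(1)] \<sigma> ys] k(2) by simp
  then show ?thesis using k(1,2) by (auto simp: eventually_eq_def)
qed

lemma cocone_t:
  assumes "is_cocone J C D Da c l" "i \<in> Obj J" "j \<in> Obj J" "le i j" "x \<in> carr (D i)"
  shows "l j (t i j x) = l i x"
  using cocone_Da[OF assms(1-3) _ assms(5)] assms Da_eq_t unfolding le_def by fastforce

lemma cocone_eventually_eq:
  assumes "is_cocone J C D Da c l" "i \<in> Obj J" "j \<in> Obj J" "x \<in> carr (D i)" "y \<in> carr (D j)"
    and "eventually_eq i x j y"
  shows "l i x = l j y"
  using assms cocone_t[OF assms(1)] unfolding eventually_eq_def by metis

text \<open>Eventual equality is an equivalence relation, so it is the kernel of the map to classes,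
  and it respects operations by \<open>eventually_eq_act\<close>. Every cocone identifies eventually
  equal points, as \<open>glue_colimit\<close> requires.\<close>

lemma directed_colimit_glue:
  obtains q where "glueing \<O> (Obj J) D q"
    and "is_colimit J C D Da (glue (Obj J) D q) (\<lambda>i. restrict (q i) (carr (D i)))"
    and "\<And>i j x y. \<lbrakk>i \<in> Obj J; j \<in> Obj J; x \<in> carr (D i); y \<in> carr (D j)\<rbrakk>
      \<Longrightarrow> q i x = q j y \<longleftrightarrow> eventually_eq i x j y"
proof -
  let ?T = "SIGMA i:Obj J. carr (D i)"
  define k where "k = (\<lambda>(i, x). {(j, y) \<in> ?T. eventually_eq i x j y})"
  obtain q' :: "_ \<Rightarrow> 'u" where q': "\<And>s t. \<lbrakk>s \<in> ?T; t \<in> ?T\<rbrakk> \<Longrightarrow> q' s = q' t \<longleftrightarrow> k s = k t"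
    using small_kernel[OF small_points, of k] by metis
  define q where "q i x = q' (i, x)" for i x
  have q: "q i x = q j y \<longleftrightarrow> eventually_eq i x j y"
    if ij: "i \<in> Obj J" "j \<in> Obj J" and xy: "x \<in> carr (D i)" "y \<in> carr (D j)" for i j x y
  proof -
    have sym: "eventually_eq i x j y \<longleftrightarrow> eventually_eq j y i x" for i x j y
      by (auto simp: eventually_eq_def)
    have "eventually_eq j y j y"
      using ij le_refl by (auto simp: eventually_eq_def)
    moreover have "q i x = q j y \<longleftrightarrow> k (i, x) = k (j, y)"
      using that q' by (simp add: q_def)
    ultimately have "q i x = q j y \<longleftrightarrow>
        (\<forall>h z. h \<in> Obj J \<and> z \<in> carr (D h) \<longrightarrow> eventually_eq i x h z = eventually_eq j y h z)"
      unfolding k_def by auto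
    also have "\<dots> \<longleftrightarrow> eventually_eq i x j y"
      using that sym eventually_eq_trans \<open>eventually_eq j y j y\<close> by meson
    finally show ?thesis .
  qed
  have gl: "glueing \<O> (Obj J) D q"
  proof (rule glueing.intro)
    fix i j \<sigma> n xs ys
    assume i: "i \<in> Obj J" and j: "j \<in> Obj J" and \<sigma>: "\<sigma> \<in> Ops \<O> n"
      and xs: "xs \<in> Nbh (D i) n" and ys: "ys \<in> Nbh (D j) n" and eq: "map (q i) xs = map (q j) ys"
    interpret Di: i_algebra \<O> "D i" by (rule D_algebra[OF i])
    interpret Dj: i_algebra \<O> "D j" by (rule D_algebra[OF j])
    have "eventually_eq i (xs ! a) j (ys ! a)" if "a < n" for a
    proof -
      have "map (q i) xs ! a = map (q j) ys ! a" using eq by simp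
      then show ?thesis
        using that Di.nbh_length[OF xs] Dj.nbh_length[OF ys] q[OF i j Di.nbh_nth[OF xs] Dj.nbh_nth[OF ys]]
        by simp
    qed
    from eventually_eq_act[OF i j \<sigma> xs ys this]
    show "q i (act (D i) n \<sigma> xs) = q j (act (D j) n \<sigma> ys)"
      using q[OF i j Di.act_closed[OF \<sigma> xs] Dj.act_closed[OF \<sigma> ys]] by blast
  qed (use clone directed D_algebra in \<open>simp_all add: directed_poset_def\<close>)
  moreover have "is_colimit J C D Da (glue (Obj J) D q) (\<lambda>i. restrict (q i) (carr (D i)))"
    using gl
  proof (rule glue_colimit)
    fix i j u x assume i: "i \<in> Obj J" "j \<in> Obj J" "u \<in> Hom J i j" and x: "x \<in> carr (D i)"
    have le: "le i j" using i by (auto simp: le_def)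
    have y: "t i j x \<in> carr (D j)" using hom_carr[OF t_hom[OF i(1,2) le] x] .
    have "t j j (t i j x) = t i j x"
      using t_t[OF i(1,2,2) le le_refl[OF i(2)] x] .
    then have "eventually_eq j (t i j x) i x"
      using i le le_refl by (auto simp: eventually_eq_def)
    then show "q j (Da i j u x) = q i x"
      using q[OF i(2,1) y x] Da_eq_t[OF i] by simp
  qed (use q cocone_eventually_eq in blast)
  ultimately show thesis using q by (rule that)
qed

section \<open>Neighbourhoods and equalities of a directed colimit, seen at a stage\<close>

context
  fixes c l assumes colimit: "is_colimit J C D Da c l"
begin

lemma colimit_cocone: "is_cocone J C D Da c l"
  using colimit by (simp add: is_colimit_def)

text \<open>Both properties hold by construction in the glued colimit and are transported to an
  arbitrary one by the comparison maps \<open>m\<close> and \<open>m'\<close>. The law that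
  \<open>m'\<close> after \<open>m\<close> is the identity recovers a tuple of \<open>c\<close> from
  its image in the glued colimit.\<close>

lemma
  shows colimit_nbh: "\<And>zs n. zs \<in> Nbh c n \<Longrightarrow> \<exists>i\<in>Obj J. \<exists>xs\<in>Nbh (D i) n. zs = map (l i) xs"
    and colimit_eq: "\<And>i j x y. \<lbrakk>i \<in> Obj J; j \<in> Obj J; x \<in> carr (D i); y \<in> carr (D j); l i x = l j y\<rbrakk>
      \<Longrightarrow> eventually_eq i x j y"
proof -
  obtain q where "glueing \<O> (Obj J) D q"
    and E: "is_colimit J C D Da (glue (Obj J) D q) (\<lambda>i. restrict (q i) (carr (D i)))"
    and q: "\<And>i j x y. \<lbrakk>i \<in> Obj J; j \<in> Obj J; x \<in> carr (D i); y \<in> carr (D j)\<rbrakk>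
      \<Longrightarrow> q i x = q j y \<longleftrightarrow> eventually_eq i x j y"
    by (rule directed_colimit_glue) (erule (1) that, simp)
  interpret glueing \<O> "Obj J" D q by fact
  let ?E = "glue (Obj J) D q" and ?l = "\<lambda>i. restrict (q i) (carr (D i))"
  have Ec: "is_cocone J C D Da ?E ?l" using E by (simp add: is_colimit_def)
  interpret c: i_algebra \<O> c using cocone_Obj[OF colimit_cocone] by (simp add: iAlg_Obj)
  obtain m where m: "i_homomorphism \<O> c ?E m" and ml': "\<And>i x. i \<in> Obj J \<Longrightarrow> x \<in> carr (D i) \<Longrightarrow> m (l i x) = ?l i x"
    by (rule colimit_factor[OF colimit Ec]) (erule that, simp)
  obtain m' where m': "i_homomorphism \<O> ?E c m'" and m'l': "\<And>i x. i \<in> Obj J \<Longrightarrow> x \<in> carr (D i) \<Longrightarrow> m' (?l i x) = l i x"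
    by (rule colimit_factor[OF E colimit_cocone]) (erule that, simp)
  have ml: "m (l i x) = q i x" and m'l: "m' (q i x) = l i x" if "i \<in> Obj J" "x \<in> carr (D i)" for i x
    using ml'[OF that] m'l'[OF that] that(2) by simp_all
  have lc: "l i \<in> extensional (carr (D i))" "\<And>x. x \<in> carr (D i) \<Longrightarrow> l i x \<in> carr c" if "i \<in> Obj J" for i
    using hom_extensional[OF cocone_hom[OF colimit_cocone that]]
      hom_carr[OF cocone_hom[OF colimit_cocone that]] by simp_all
  have "compose (carr c) m' m = (\<lambda>x\<in>carr c. x)"
  proof (rule colimit_hom_eqI[OF colimit])
    show "i_homomorphism \<O> c c (compose (carr c) m' m)" by (rule hom_compose[OF c.i_algebra_axioms m m'])
    show "i_homomorphism \<O> c c (\<lambda>x\<in>carr c. x)" by (rule hom_idn[OF c.i_algebra_axioms])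
  qed (simp_all add: compose_eq lc ml m'l cocone_Obj[OF colimit_cocone])
  from fun_cong[OF this] have m'm: "m' (m z) = z" if "z \<in> carr c" for z
    using that by (metis compose_eq restrict_apply')
  show "\<exists>i\<in>Obj J. \<exists>xs\<in>Nbh (D i) n. zs = map (l i) xs" if zs: "zs \<in> Nbh c n" for zs n
  proof -
    from hom_nbh[OF m zs] obtain i xs where i: "i \<in> Obj J" "xs \<in> Nbh (D i) n" "map m zs = map (q i) xs"
      by (rule glue_NbhE)
    interpret Di: i_algebra \<O> "D i" by (rule D_algebra[OF i(1)])
    have "zs = map m' (map m zs)"
      using c.nbh_set[OF zs] m'm by (auto intro!: map_idI[symmetric])
    also have "\<dots> = map (l i) xs"
      using Di.nbh_set[OF i(2)] m'l[OF i(1)] unfolding i(3) by auto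
    finally show ?thesis using i by blast
  qed
  show "eventually_eq i x j y" if "i \<in> Obj J" "j \<in> Obj J" "x \<in> carr (D i)" "y \<in> carr (D j)" "l i x = l j y"
    for i j x y
    using q[OF that(1-4)] ml[OF that(1,3)] ml[OF that(2,4)] that(5) by simp
qed

end

end

section \<open>Finite presentability\<close>

text \<open>Joint surjectivity forces the values of a mediating map; equality at a common later
  object makes these values well defined.\<close>

lemma SET_colimitI:
  assumes cocone: "is_cocone J SET F a T L"
    and surj: "\<And>z. z \<in> T \<Longrightarrow> \<exists>i\<in>Obj J. \<exists>x\<in>F i. z = L i x"
    and inj: "\<And>i j x y. \<lbrakk>i \<in> Obj J; j \<in> Obj J; x \<in> F i; y \<in> F j; L i x = L j y\<rbrakk>
      \<Longrightarrow> \<exists>k\<in>Obj J. \<exists>u\<in>Hom J i k. \<exists>v\<in>Hom J j k. a i k u x = a j k v y"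
  shows "is_colimit J SET F a T L"
proof -
  have L: "L i x \<in> T" if "i \<in> Obj J" "x \<in> F i" for i x
    using cocone that by (auto simp: is_cocone_def SET_def)
  have "\<exists>!m. m \<in> T \<rightarrow>\<^sub>E T' \<and> (\<forall>i\<in>Obj J. compose (F i) m (L i) = L' i)"
    if c: "is_cocone J SET F a T' L'" for T' L'
  proof -
    have L': "L' i \<in> F i \<rightarrow>\<^sub>E T'" if "i \<in> Obj J" for i
      using c that by (simp add: is_cocone_def SET_def)
    have L'_a: "L' j (a i j u x) = L' i x"
      if "i \<in> Obj J" "j \<in> Obj J" "u \<in> Hom J i j" "x \<in> F i" for i j u x
    proof -
      have "compose (F i) (L' j) (a i j u) = L' i" using c that by (simp add: is_cocone_def SET_def)
      from fun_cong[OF this, of x] show ?thesis using that(4) by (simp add: compose_eq)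
    qed
    have wd: "L' i x = L' j y"
      if xy: "i \<in> Obj J" "j \<in> Obj J" "x \<in> F i" "y \<in> F j" "L i x = L j y" for i j x y
    proof -
      obtain k u v where "k \<in> Obj J" "u \<in> Hom J i k" "v \<in> Hom J j k" "a i k u x = a j k v y"
        using inj[OF xy] by auto
      then show ?thesis using L'_a[of i k u x] L'_a[of j k v y] xy by simp
    qed
    define m where "m = (\<lambda>z\<in>T. SOME w. \<exists>i\<in>Obj J. \<exists>x\<in>F i. z = L i x \<and> w = L' i x)"
    have m: "m (L i x) = L' i x" if "i \<in> Obj J" "x \<in> F i" for i x
    proof -
      have "(SOME w. \<exists>j\<in>Obj J. \<exists>y\<in>F j. L i x = L j y \<and> w = L' j y) = L' i x"
        by (rule some_equality) (use that wd[OF that(1) _ that(2)] in metis)+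
      then show ?thesis using L[OF that] by (simp add: m_def)
    qed
    show ?thesis
    proof (intro ex1I[of _ m] conjI ballI)
      show "m \<in> T \<rightarrow>\<^sub>E T'"
      proof (rule PiE_I)
        fix z assume "z \<in> T"
        then obtain i x where "i \<in> Obj J" "x \<in> F i" "z = L i x" using surj by blast
        then show "m z \<in> T'" using m L' by auto
      qed (simp add: m_def)
      show "compose (F i) m (L i) = L' i" if "i \<in> Obj J" for i
        by (rule extensionalityI[of _ "F i"])
          (use L'[OF that] m that in \<open>auto simp: compose_eq PiE_def\<close>)
    next
      fix m' assume m': "m' \<in> T \<rightarrow>\<^sub>E T' \<and> (\<forall>i\<in>Obj J. compose (F i) m' (L i) = L' i)"
      show "m' = m"
      proof (rule extensionalityI[of _ T])
        fix z assume "z \<in> T"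
        then obtain i x where i: "i \<in> Obj J" "x \<in> F i" "z = L i x" using surj by blast
        have "compose (F i) m' (L i) x = L' i x" using m' i(1) by simp
        then show "m' z = m z" using i m by (simp add: compose_eq)
      qed (use m' in \<open>auto simp: m_def PiE_def\<close>)
    qed
  qed
  then show ?thesis using cocone by (simp add: is_colimit_def SET_def)
qed

section \<open>Homomorphisms from a finitely presented algebra into a directed colimit\<close>

context directed_diagram
begin

context
  fixes N :: "'p set" and ar R and K :: "('f, 'u) ialg" and g c l
  assumes K: "presents \<O> N ar R K g" and R: "valid_relations \<O> N ar R"
    and finite: "finite N" "finite R"
    and colimit: "is_colimit J C D Da c l"
begin

lemma K_algebra: "i_algebra \<O> K"
  using presents_Obj[OF K] by (simp add: iAlg_Obj)

lemma relation_ops: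
  assumes "((p, \<sigma>), (p', \<tau>)) \<in> R"
  shows "p \<in> N" "\<sigma> \<in> Ops \<O> (ar p)" "p' \<in> N" "\<tau> \<in> Ops \<O> (ar p')"
  using assms R by (auto simp: valid_relations_def)

text \<open>Each of the finitely many neighbourhoods \<open>map h (g p)\<close> lifts to a stage.
  The relations hold for the lifts in the colimit, hence all of them hold at one stage, which then
  receives a homomorphism from \<open>K\<close> by the presentation.\<close>

lemma hom_to_colimit_lifts:
  assumes h: "i_homomorphism \<O> K c h"
  shows "\<exists>i\<in>Obj J. \<exists>h'. i_homomorphism \<O> K (D i) h' \<and> h = compose (carr K) (l i) h'"
proof -
  note cocone = colimit_cocone[OF colimit]
  have "\<forall>p\<in>N. \<exists>s. fst s \<in> Obj J \<and> snd s \<in> Nbh (D (fst s)) (ar p) \<and> map h (g p) = map (l (fst s)) (snd s)"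
    using colimit_nbh[OF colimit hom_nbh[OF h presents_nbh[OF K]]] by force
  then obtain s where s: "\<forall>p\<in>N. fst (s p) \<in> Obj J \<and> snd (s p) \<in> Nbh (D (fst (s p))) (ar p)
      \<and> map h (g p) = map (l (fst (s p))) (snd (s p))"
    using bchoice[of N] by meson
  define i where "i p = fst (s p)" for p
  define z where "z p = snd (s p)" for p
  have iz: "i p \<in> Obj J" "z p \<in> Nbh (D (i p)) (ar p)" "map h (g p) = map (l (i p)) (z p)" if "p \<in> N" for p
    using s that by (simp_all add: i_def z_def)
  \<comment> \<open>The point at stage \<open>i p\<close> that a side of a relation denotes, before
    all lifts are moved to a common stage.\<close>
  define a where "a p \<sigma> = act (D (i p)) (ar p) \<sigma> (z p)" for p \<sigma>
  have a: "a p \<sigma> \<in> carr (D (i p))" "l (i p) (a p \<sigma>) = act c (ar p) \<sigma> (map h (g p))"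
    if p: "p \<in> N" "\<sigma> \<in> Ops \<O> (ar p)" for p \<sigma>
  proof -
    interpret i_algebra \<O> "D (i p)" by (rule D_algebra[OF iz(1)[OF p(1)]])
    show "a p \<sigma> \<in> carr (D (i p))" unfolding a_def by (rule act_closed[OF p(2) iz(2)[OF p(1)]])
    show "l (i p) (a p \<sigma>) = act c (ar p) \<sigma> (map h (g p))"
      unfolding a_def iz(3)[OF p(1)] by (rule hom_act[OF cocone_hom[OF cocone iz(1)[OF p(1)]] p(2) iz(2)[OF p(1)]])
  qed
  obtain k where k: "k \<in> Obj J" "\<forall>j\<in>i ` N. le j k"
    and rel: "\<forall>j x j' y. (j, x, j', y) \<in> (\<lambda>((p, \<sigma>), (p', \<tau>)). (i p, a p \<sigma>, i p', a p' \<tau>)) ` R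
      \<longrightarrow> le j k \<and> le j' k \<and> t j k x = t j' k y"
  proof (rule eventually_eq_finite)
    show "finite ((\<lambda>((p, \<sigma>), (p', \<tau>)). (i p, a p \<sigma>, i p', a p' \<tau>)) ` R)" "finite (i ` N)"
      using finite by simp_all
    show "i ` N \<subseteq> Obj J" using iz by auto
    fix j x j' y assume "(j, x, j', y) \<in> (\<lambda>((p, \<sigma>), (p', \<tau>)). (i p, a p \<sigma>, i p', a p' \<tau>)) ` R"
    then obtain p \<sigma> p' \<tau> where r: "((p, \<sigma>), (p', \<tau>)) \<in> R" and eq: "j = i p" "x = a p \<sigma>" "j' = i p'" "y = a p' \<tau>"
      by auto
    note p = relation_ops[OF r]
    have "act c (ar p) \<sigma> (map h (g p)) = act c (ar p') \<tau> (map h (g p'))"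
      using hom_act[OF h p(2) presents_nbh[OF K p(1)]] hom_act[OF h p(4) presents_nbh[OF K p(3)]]
        presents_relation[OF K r] by simp
    then have "l (i p) (a p \<sigma>) = l (i p') (a p' \<tau>)"
      using a p by simp
    then show "j \<in> Obj J \<and> j' \<in> Obj J \<and> x \<in> carr (D j) \<and> y \<in> carr (D j') \<and> eventually_eq j x j' y"
      using colimit_eq[OF colimit] a(1) iz(1) p unfolding eq by simp
  qed
  define y where "y p = map (t (i p) k) (z p)" for p
  have tk: "i_homomorphism \<O> (D (i p)) (D k) (t (i p) k)" if "p \<in> N" for p
    using t_hom[OF iz(1)[OF that] k(1)] k(2) that by blast
  have act_y: "act (D k) (ar p) \<sigma> (y p) = t (i p) k (a p \<sigma>)" if p: "p \<in> N" "\<sigma> \<in> Ops \<O> (ar p)" for p \<sigma>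
    unfolding a_def y_def by (rule hom_act[OF tk[OF p(1)] p(2) iz(2)[OF p(1)], symmetric])
  have "satisfies N ar R (D k) y"
    unfolding satisfies_def
  proof (intro conjI ballI allI impI)
    show "y p \<in> Nbh (D k) (ar p)" if "p \<in> N" for p
      unfolding y_def by (rule hom_nbh[OF tk[OF that] iz(2)[OF that]])
    fix p \<sigma> p' \<tau> assume r: "((p, \<sigma>), (p', \<tau>)) \<in> R"
    have "(i p, a p \<sigma>, i p', a p' \<tau>) \<in> (\<lambda>((p, \<sigma>), (p', \<tau>)). (i p, a p \<sigma>, i p', a p' \<tau>)) ` R"
      using r by force
    then show "act (D k) (ar p) \<sigma> (y p) = act (D k) (ar p') \<tau> (y p')"
      using rel relation_ops[OF r] by (simp add: act_y)
  qed
  with K obj_closed[OF k(1)] obtain h' where h': "i_homomorphism \<O> K (D k) h'" and gy: "\<forall>p\<in>N. map h' (g p) = y p"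
    unfolding presents_def by meson
  have lh': "i_homomorphism \<O> K c (compose (carr K) (l k) h')"
    by (rule hom_compose[OF K_algebra h' cocone_hom[OF cocone k(1)]])
  \<comment> \<open>It suffices to compare on generators, where both sides give the image in
    \<open>c\<close> of the lift \<open>z p\<close>.\<close>
  have "h = compose (carr K) (l k) h'"
  proof (rule presents_hom_eqI[OF K cocone_Obj[OF cocone] R h lh'])
    fix p assume p: "p \<in> N"
    interpret K: i_algebra \<O> K by (rule K_algebra)
    interpret Dp: i_algebra \<O> "D (i p)" by (rule D_algebra[OF iz(1)[OF p]])
    have "map (compose (carr K) (l k) h') (g p) = map (l k) (y p)"
      by (simp only: map_compose[OF K.nbh_set[OF presents_nbh[OF K p]]] gy[rule_format, OF p])
    also have "\<dots> = map (l (i p)) (z p)"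
      using cocone_t[OF cocone iz(1)[OF p] k(1)] k(2) p Dp.nbh_set[OF iz(2)[OF p]]
      by (auto simp: y_def)
    finally show "map h (g p) = map (compose (carr K) (l k) h') (g p)"
      using iz(3)[OF p] by simp
  qed
  then show ?thesis using k(1) h' by blast
qed

text \<open>Homomorphisms from \<open>K\<close> are determined by the finitely many entries of the
  generating tuples, and finitely many equalities in the colimit hold at one stage.\<close>

lemma homs_to_colimit_eventually_eq:
  assumes ij: "i \<in> Obj J" "j \<in> Obj J"
    and h: "i_homomorphism \<O> K (D i) h" and h': "i_homomorphism \<O> K (D j) h'"
    and eq: "compose (carr K) (l i) h = compose (carr K) (l j) h'"
  shows "\<exists>k\<in>Obj J. le i k \<and> le j k \<and> compose (carr K) (t i k) h = compose (carr K) (t j k) h'"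
proof -
  interpret K: i_algebra \<O> K by (rule K_algebra)
  define P where "P = (\<lambda>x. (i, h x, j, h' x)) ` (\<Union>p\<in>N. set (g p))"
  obtain k where k: "k \<in> Obj J" "\<forall>i'\<in>{i, j}. le i' k"
    and t: "\<forall>i' x j' y. (i', x, j', y) \<in> P \<longrightarrow> le i' k \<and> le j' k \<and> t i' k x = t j' k y"
  proof (rule eventually_eq_finite)
    show "finite P" "finite {i, j}" "{i, j} \<subseteq> Obj J" using finite ij by (simp_all add: P_def)
    fix i' x j' y assume "(i', x, j', y) \<in> P"
    then obtain p w where p: "p \<in> N" "w \<in> set (g p)" and *: "i' = i" "x = h w" "j' = j" "y = h' w"
      by (auto simp: P_def)
    have w: "w \<in> carr K" using K.nbh_set[OF presents_nbh[OF K p(1)]] p(2) by blast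
    have "l i (h w) = l j (h' w)" using fun_cong[OF eq, of w] w by (simp add: compose_eq)
    then show "i' \<in> Obj J \<and> j' \<in> Obj J \<and> x \<in> carr (D i') \<and> y \<in> carr (D j') \<and> eventually_eq i' x j' y"
      using colimit_eq[OF colimit ij hom_carr[OF h w] hom_carr[OF h' w]] ij hom_carr[OF h w] hom_carr[OF h' w]
      unfolding * by simp
  qed
  have le: "le i k" "le j k" using k(2) by simp_all
  have "compose (carr K) (t i k) h = compose (carr K) (t j k) h'"
  proof (rule presents_hom_eqI[OF K obj_closed[OF k(1)] R])
    show "i_homomorphism \<O> K (D k) (compose (carr K) (t i k) h)"
      by (rule hom_compose[OF K_algebra h t_hom[OF ij(1) k(1) le(1)]])
    show "i_homomorphism \<O> K (D k) (compose (carr K) (t j k) h')"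
      by (rule hom_compose[OF K_algebra h' t_hom[OF ij(2) k(1) le(2)]])
    fix p assume p: "p \<in> N"
    have "t i k (h w) = t j k (h' w)" if "w \<in> set (g p)" for w
    proof -
      have "(i, h w, j, h' w) \<in> P" using that p by (auto simp: P_def)
      then show ?thesis using t by blast
    qed
    then show "map (compose (carr K) (t i k) h) (g p) = map (compose (carr K) (t j k) h') (g p)"
      unfolding map_compose[OF K.nbh_set[OF presents_nbh[OF K p]]] by simp
  qed
  then show ?thesis using k(1) le by blast
qed

lemma Hom_preserves_colimit:
  "is_colimit J SET (\<lambda>i. Hom C K (D i)) (\<lambda>i j u. \<lambda>h\<in>Hom C K (D i). Cmp C K (D i) (D j) (Da i j u) h)
     (Hom C K c) (\<lambda>i. \<lambda>h\<in>Hom C K (D i). Cmp C K (D i) c (l i) h)"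
  (is "is_colimit J SET ?F ?a ?T ?L")
proof (rule SET_colimitI)
  note cocone = colimit_cocone[OF colimit]
  note comp = hom_compose[OF K_algebra]
  show "is_cocone J SET ?F ?a ?T ?L"
    unfolding is_cocone_def
  proof (intro conjI ballI)
    show "?T \<in> Obj SET" by (simp add: SET_def)
    show "?L i \<in> Hom SET (?F i) ?T" if "i \<in> Obj J" for i
      using comp cocone_hom[OF cocone that] by (auto simp: SET_def iAlg_Hom iAlg_Cmp)
    fix i j u assume i: "i \<in> Obj J" "j \<in> Obj J" "u \<in> Hom J i j"
    show "Cmp SET (?F i) (?F j) ?T (?L j) (?a i j u) = ?L i"
    proof (rule extensionalityI[of _ "?F i"])
      fix h assume h: "h \<in> ?F i"
      have hx: "h x \<in> carr (D i)" if "x \<in> carr K" for x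
        using h hom_carr[OF _ that] by (auto simp: iAlg_Hom)
      have "compose (carr K) (Da i j u) h \<in> ?F j"
        using h comp[OF _ Da_hom[OF i]] by (simp add: iAlg_Hom)
      moreover have "compose (carr K) (l j) (compose (carr K) (Da i j u) h) = compose (carr K) (l i) h"
        by (rule extensionalityI[of _ "carr K"])
          (use hx cocone_Da[OF cocone i] in \<open>auto simp: compose_eq\<close>)
      ultimately show "Cmp SET (?F i) (?F j) ?T (?L j) (?a i j u) h = ?L i h"
        using h by (simp add: SET_def iAlg_Cmp compose_eq)
    qed (simp_all add: SET_def)
  qed
  show "\<exists>i\<in>Obj J. \<exists>h'\<in>?F i. h = ?L i h'" if "h \<in> ?T" for h
    using hom_to_colimit_lifts[of h] that by (force simp: iAlg_Hom iAlg_Cmp)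
  fix i j h h' assume i: "i \<in> Obj J" "j \<in> Obj J" and h: "h \<in> ?F i" "h' \<in> ?F j" and "?L i h = ?L j h'"
  then have "compose (carr K) (l i) h = compose (carr K) (l j) h'"
    by (simp add: iAlg_Cmp)
  then obtain k where k: "k \<in> Obj J" "le i k" "le j k"
    "compose (carr K) (t i k) h = compose (carr K) (t j k) h'"
    using homs_to_colimit_eventually_eq[OF i] h by (auto simp: iAlg_Hom)
  then obtain u v where u: "u \<in> Hom J i k" "v \<in> Hom J j k" by (auto simp: le_def)
  have "?a i k u h = ?a j k v h'"
    using h k(4) by (simp add: iAlg_Cmp Da_eq_t[OF i(1) k(1) u(1)] Da_eq_t[OF i(2) k(1) u(2)])
  then show "\<exists>k\<in>Obj J. \<exists>u\<in>Hom J i k. \<exists>v\<in>Hom J j k. ?a i k u h = ?a j k v h'"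
    using k(1) u by blast
qed

end

end

lemma finitely_presented_finitely_presentable:
  fixes K :: "('f, 'u) ialg"
  assumes "universe TYPE('u)" "is_clone \<O>"
    and K: "presents \<O> N ar R K g" "valid_relations \<O> N ar R" "finite N" "finite R"
  shows "finitely_presentable TYPE('u) (iAlg \<O>) K"
  unfolding finitely_presentable_def
proof (intro conjI allI impI)
  show "K \<in> Obj (iAlg \<O>)" by (rule presents_Obj[OF K(1)])
  fix J :: "('u, 'u) category" and D :: "'u \<Rightarrow> ('f, 'u) ialg" and Da c l
  assume "small_category J \<and> directed_poset J \<and> is_functor J (iAlg \<O>) D Da \<and> is_colimit J (iAlg \<O>) D Da c l"
  then have J: "small_category J" "directed_poset J" "is_functor J (iAlg \<O>) D Da"
    and colimit: "is_colimit J (iAlg \<O>) D Da c l"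
    by blast+
  interpret directed_diagram \<O> J D Da
    using assms(1,2) J
    by (simp add: directed_diagram_def directed_diagram_axioms_def diagram_def diagram_axioms_def
        small_category_def)
  show "is_colimit J SET (\<lambda>i. Hom (iAlg \<O>) K (D i))
      (\<lambda>i j u. \<lambda>h\<in>Hom (iAlg \<O>) K (D i). Cmp (iAlg \<O>) K (D i) (D j) (Da i j u) h)
      (Hom (iAlg \<O>) K c) (\<lambda>i. \<lambda>h\<in>Hom (iAlg \<O>) K (D i). Cmp (iAlg \<O>) K (D i) c (l i) h)"
    by (rule Hom_preserves_colimit[OF K colimit])
qed

section \<open>Every algebra is a directed colimit of finitely presented ones\<close>

text \<open>Lets a presentation with generators named by natural numbers serve for any finite set of
  names.\<close>

lemma presents_reindex:
  fixes K :: "('f, 'u) ialg"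
  assumes K: "presents \<O> N' ar' R' K g" and b: "bij_betw b N N'"
    and ar: "\<And>p. p \<in> N \<Longrightarrow> ar' (b p) = ar p"
    and R': "R' = map_prod (map_prod b id) (map_prod b id) ` R"
    and R: "valid_relations \<O> N ar R"
  shows "presents \<O> N ar R K (\<lambda>p. g (b p))"
proof -
  have N': "N' = b ` N" using b by (simp add: bij_betw_def)
  have sat: "satisfies N' ar' R' B ys' \<longleftrightarrow> satisfies N ar R B ys"
    if ys: "\<And>p. p \<in> N \<Longrightarrow> ys' (b p) = ys p" for B :: "('f, 'u) ialg" and ys ys'
  proof -
    have image: "(\<forall>q \<sigma> q' \<tau>. ((q, \<sigma>), (q', \<tau>)) \<in> R' \<longrightarrow> \<Phi> q \<sigma> q' \<tau>)
        \<longleftrightarrow> (\<forall>p \<sigma> p' \<tau>. ((p, \<sigma>), (p', \<tau>)) \<in> R \<longrightarrow> \<Phi> (b p) \<sigma> (b p') \<tau>)" for \<Phi>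
      unfolding R' by force
    have "act B (ar' (b p)) \<sigma> (ys' (b p)) = act B (ar' (b p')) \<tau> (ys' (b p'))
        \<longleftrightarrow> act B (ar p) \<sigma> (ys p) = act B (ar p') \<tau> (ys p')"
      if "((p, \<sigma>), (p', \<tau>)) \<in> R" for p \<sigma> p' \<tau>
    proof -
      have "p \<in> N" "p' \<in> N" using R that by (auto simp: valid_relations_def)
      then show ?thesis by (simp add: ys ar)
    qed
    then show ?thesis
      unfolding satisfies_def image N' using ys ar by simp
  qed
  show ?thesis
    unfolding presents_def
  proof (intro conjI ballI allI impI)
    show "K \<in> Obj (iAlg \<O>)" by (rule presents_Obj[OF K])
    show "satisfies N ar R K (\<lambda>p. g (b p))"
      using sat[of g "\<lambda>p. g (b p)" K] K by (simp add: presents_def)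
    fix B :: "('f, 'u) ialg" and ys assume B: "B \<in> Obj (iAlg \<O>)" and ys: "satisfies N ar R B ys"
    \<comment> \<open>The family is renamed along the inverse of \<open>b\<close> so that the
      universal property over \<open>N'\<close> applies.\<close>
    define ys' where "ys' q = ys (inv_into N b q)" for q
    have ys': "ys' (b p) = ys p" if "p \<in> N" for p
      using that b by (simp add: ys'_def bij_betw_def)
    then have "satisfies N' ar' R' B ys'" using sat ys by blast
    then have "\<exists>!h. i_homomorphism \<O> K B h \<and> (\<forall>q\<in>N'. map h (g q) = ys' q)"
      using K B by (simp add: presents_def)
    then show "\<exists>!h. i_homomorphism \<O> K B h \<and> (\<forall>p\<in>N. map h (g (b p)) = ys p)"
      by (simp add: N' ys')
  qed
qed

text \<open>Up to renaming of generators, a finite presentation is a list of arities with a list of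
  relations over positions in it. Such codes form a small set, and \<open>S\<close> consists of one
  chosen algebra for each valid code.\<close>

lemma finite_presentations:
  fixes \<O> :: "'f clone"
  assumes U: "universe TYPE('u)" and \<O>: "is_clone \<O>" "\<And>n. small TYPE('u) (Ops \<O> n)"
  obtains S :: "('f, 'u) ialg set" where "small TYPE('u) S"
    and "\<And>K. K \<in> S \<Longrightarrow> finitely_presentable TYPE('u) (iAlg \<O>) K"
    and "\<And>(N :: 'p set) ar R. \<lbrakk>finite N; N \<noteq> {}; finite R; valid_relations \<O> N ar R\<rbrakk>
      \<Longrightarrow> \<exists>K\<in>S. \<exists>g. presents \<O> N ar R K g"
proof -
  define T where "T = lists (UNIV :: nat set) \<times> lists (((UNIV :: nat set) \<times> (\<Union>n. Ops \<O> n)) \<times> (UNIV :: nat set) \<times> (\<Union>n. Ops \<O> n))"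
  \<comment> \<open>An empty list of arities is excluded because an algebra cannot be glued from no
    summands.\<close>
  define P where "P = {(ns, rs) \<in> T. ns \<noteq> [] \<and> valid_relations \<O> {..<length ns} ((!) ns) (set rs)}"
  define K where "K = (\<lambda>(ns, rs). SOME K :: ('f, 'u) ialg. \<exists>g. presents \<O> {..<length ns} ((!) ns) (set rs) K g)"
  have K: "\<exists>g. presents \<O> {..<length ns} ((!) ns) (set rs) (K (ns, rs)) g" if p: "(ns, rs) \<in> P" for ns rs
  proof -
    obtain K' :: "('f, 'u) ialg" and g where "presents \<O> {..<length ns} ((!) ns) (set rs) K' g"
      by (rule presentation_exists[OF U \<O>, of "{..<length ns}" "(!) ns" "set rs"])
        (use p in \<open>auto simp: P_def small_finite[OF U] lessThan_empty_iff bot_nat_def\<close>)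
    then have "\<exists>K' :: ('f, 'u) ialg. \<exists>g. presents \<O> {..<length ns} ((!) ns) (set rs) K' g" by blast
    from someI_ex[OF this] show ?thesis by (simp add: K_def)
  qed
  have "small TYPE('u) T"
    unfolding T_def by (intro small_Sigma small_lists small_UN small_nat U \<O>)
  moreover have "P \<subseteq> T" by (auto simp: P_def)
  ultimately have "small TYPE('u) (K ` P)" by (intro small_image) (rule small_subset)
  moreover have "finitely_presentable TYPE('u) (iAlg \<O>) k" if k: "k \<in> K ` P" for k
  proof -
    obtain ns rs where p: "(ns, rs) \<in> P" "k = K (ns, rs)" using k by auto
    then obtain g where "presents \<O> {..<length ns} ((!) ns) (set rs) k g" using K by blast
    then show ?thesis
      by (rule finitely_presented_finitely_presentable[OF U \<O>(1)]) (use p in \<open>auto simp: P_def\<close>)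
  qed
  moreover have "\<exists>k\<in>K ` P. \<exists>g. presents \<O> N ar R k g"
    if N: "finite N" "N \<noteq> {}" and "finite R" and R: "valid_relations \<O> N ar R"
    for N :: "'p set" and ar R
  proof -
    obtain L where L: "set L = N" "distinct L" using finite_distinct_list[OF N(1)] by blast
    \<comment> \<open>The position of a generator in the enumeration \<open>L\<close> of
      \<open>N\<close>.\<close>
    define b where "b = inv_into {..<length L} ((!) L)"
    have nth: "bij_betw ((!) L) {..<length L} N" using L by (intro bij_betw_nth) auto
    have b: "bij_betw b N {..<length L}" unfolding b_def by (rule bij_betw_inv_into[OF nth])
    have b_less: "b p < length L" and L_b: "L ! b p = p" if "p \<in> N" for p
      using that b bij_betw_inv_into_right[OF nth] by (auto simp: b_def bij_betw_def)
    define R' where "R' = map_prod (map_prod b id) (map_prod b id) ` R"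
    obtain rs where rs: "set rs = R'" using finite_list[of R'] \<open>finite R\<close> by (auto simp: R'_def)
    let ?ns = "map ar L"
    have R_N: "p \<in> N \<and> p' \<in> N \<and> \<sigma> \<in> Ops \<O> (ar p) \<and> \<tau> \<in> Ops \<O> (ar p')" if "((p, \<sigma>), (p', \<tau>)) \<in> R" for p \<sigma> p' \<tau>
      using R that by (auto simp: valid_relations_def)
    have ns_b: "?ns ! b p = ar p" if "p \<in> N" for p
      using b_less[OF that] L_b[OF that] by simp
    have "valid_relations \<O> {..<length ?ns} ((!) ?ns) R'"
      unfolding valid_relations_def R'_def using R_N b_less ns_b by fastforce
    moreover have "?ns \<noteq> []" using N(2) L by auto
    moreover have "rs \<in> lists ((UNIV \<times> (\<Union>n. Ops \<O> n)) \<times> UNIV \<times> (\<Union>n. Ops \<O> n))"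
      unfolding lists_eq_set mem_Collect_eq rs R'_def using R_N by fastforce
    ultimately have "(?ns, rs) \<in> P" by (simp add: P_def T_def rs)
    with K obtain g where "presents \<O> {..<length ?ns} ((!) ?ns) R' (K (?ns, rs)) g"
      using rs by blast
    then have "presents \<O> N ar R (K (?ns, rs)) (\<lambda>p. g (b p))"
      by (rule presents_reindex) (use b ns_b R in \<open>simp_all add: R'_def\<close>)
    then show ?thesis using \<open>(?ns, rs) \<in> P\<close> by blast
  qed
  ultimately show thesis by (rule that)
qed

section \<open>The diagram of finite sets of relations over a fixed algebra\<close>

definition neighbourhoods :: "('f, 'a) ialg \<Rightarrow> (nat \<times> 'a list) set" where
  "neighbourhoods X = (SIGMA n:UNIV. Nbh X n)"

text \<open>The kernel pair of the evaluation map to \<open>X\<close> from the disjoint union of the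
  free algebras on all its neighbourhoods. The arity stored in a neighbourhood lets
  \<open>fst\<close> serve as the arity function.\<close>

definition relations :: "'f clone \<Rightarrow> ('f, 'a) ialg
    \<Rightarrow> (((nat \<times> 'a list) \<times> 'f) \<times> ((nat \<times> 'a list) \<times> 'f)) set" where
  "relations \<O> X = {((p, \<sigma>), (p', \<tau>)). p \<in> neighbourhoods X \<and> p' \<in> neighbourhoods X
     \<and> \<sigma> \<in> Ops \<O> (fst p) \<and> \<tau> \<in> Ops \<O> (fst p')
     \<and> act X (fst p) \<sigma> (snd p) = act X (fst p') \<tau> (snd p')}"

text \<open>The empty neighbourhood is included so that every presentation has at least one generator.\<close>

definition generators :: "(((nat \<times> 'a list) \<times> 'f) \<times> ((nat \<times> 'a list) \<times> 'f)) set \<Rightarrow> (nat \<times> 'a list) set" where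
  "generators P = insert (0, []) (fst ` fst ` P \<union> fst ` snd ` P)"

lemma relations_valid:
  assumes "P \<subseteq> relations \<O> X"
  shows "valid_relations \<O> (generators P) fst P"
  unfolding valid_relations_def
proof
  fix r assume r: "r \<in> P"
  obtain p \<sigma> p' \<tau> where "r = ((p, \<sigma>), (p', \<tau>))" by (metis surj_pair)
  moreover have "fst (fst r) \<in> generators P" "fst (snd r) \<in> generators P"
    using r by (simp_all add: generators_def)
  ultimately show "r \<in> (SIGMA p:generators P. Ops \<O> (fst p)) \<times> (SIGMA p:generators P. Ops \<O> (fst p))"
    using r assms by (auto simp: relations_def)
qed

text \<open>The algebras \<open>K P\<close> are parameters, so that they can later be picked from
  the small set of finitely presentable algebras.\<close>

locale approximation =
  fixes \<O> :: "'f clone" and X :: "('f, 'u) ialg"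
    and K :: "(((nat \<times> 'u list) \<times> 'f) \<times> ((nat \<times> 'u list) \<times> 'f)) set \<Rightarrow> ('f, 'u) ialg"
    and g :: "(((nat \<times> 'u list) \<times> 'f) \<times> ((nat \<times> 'u list) \<times> 'f)) set \<Rightarrow> nat \<times> 'u list \<Rightarrow> 'u list"
  assumes U: "universe TYPE('u)" and clone: "is_clone \<O>" and small_Ops: "\<And>n. small TYPE('u) (Ops \<O> n)"
    and X: "X \<in> Obj (iAlg \<O>)"
    and K: "P \<in> Fpow (relations \<O> X) \<Longrightarrow> presents \<O> (generators P) fst P (K P) (g P)"
begin

abbreviation "index \<equiv> Fpow (relations \<O> X)"

sublocale X: i_algebra \<O> X
  using X by (simp add: iAlg_Obj)

lemma generators_nbh: "P \<in> index \<Longrightarrow> p \<in> generators P \<Longrightarrow> snd p \<in> Nbh X (fst p)"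
  by (fastforce simp: generators_def Fpow_def relations_def neighbourhoods_def X.nbh_Nil)

lemma index_valid: "P \<in> index \<Longrightarrow> valid_relations \<O> (generators P) fst P"
  by (rule relations_valid[of P \<O> X]) (simp add: Fpow_def)

lemma index_satisfied: "P \<in> index \<Longrightarrow> satisfies (generators P) fst P X snd"
  using generators_nbh by (auto simp: satisfies_def Fpow_def relations_def)

lemma K_Obj: "P \<in> index \<Longrightarrow> K P \<in> Obj (iAlg \<O>)"
  using presents_Obj[OF K] .

lemma K_algebra: "P \<in> index \<Longrightarrow> i_algebra \<O> (K P)"
  using K_Obj by (simp add: iAlg_Obj)

lemma K_hom_eqI:
  fixes B :: "('f, 'u) ialg"
  assumes "P \<in> index" "B \<in> Obj (iAlg \<O>)" "i_homomorphism \<O> (K P) B h" "i_homomorphism \<O> (K P) B h'"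
    and "\<And>p. p \<in> generators P \<Longrightarrow> map h (g P p) = map h' (g P p)"
  shows "h = h'"
  by (rule presents_hom_eqI[OF K[OF assms(1)] assms(2) index_valid[OF assms(1)] assms(3-5)])

lemma g_nbh: "P \<in> index \<Longrightarrow> p \<in> generators P \<Longrightarrow> g P p \<in> Nbh (K P) (fst p)"
  by (rule presents_nbh[OF K])

lemma map_compose_g:
  assumes "P \<in> index" "p \<in> generators P"
  shows "map (compose (carr (K P)) h h') (g P p) = map h (map h' (g P p))"
proof -
  interpret i_algebra \<O> "K P" by (rule K_algebra[OF assms(1)])
  show ?thesis by (rule map_compose[OF nbh_set[OF g_nbh[OF assms]]])
qed

definition to_X where
  "to_X P = (SOME h. i_homomorphism \<O> (K P) X h \<and> (\<forall>p\<in>generators P. map h (g P p) = snd p))"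

definition trans where
  "trans P Q = (SOME h. i_homomorphism \<O> (K P) (K Q) h \<and> (\<forall>p\<in>generators P. map h (g P p) = g Q p))"

lemma to_X:
  assumes "P \<in> index"
  shows to_X_hom: "i_homomorphism \<O> (K P) X (to_X P)"
    and to_X_g: "\<And>p. p \<in> generators P \<Longrightarrow> map (to_X P) (g P p) = snd p"
proof -
  have "\<exists>!h. i_homomorphism \<O> (K P) X h \<and> (\<forall>p\<in>generators P. map h (g P p) = snd p)"
    using K[OF assms] X index_satisfied[OF assms] by (simp add: presents_def)
  from someI_ex[OF ex1_implies_ex[OF this]]
  show "i_homomorphism \<O> (K P) X (to_X P)" "\<And>p. p \<in> generators P \<Longrightarrow> map (to_X P) (g P p) = snd p"
    by (simp_all add: to_X_def)
qed

lemma generators_mono: "P \<subseteq> Q \<Longrightarrow> generators P \<subseteq> generators Q"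
  by (auto simp: generators_def)

lemma trans:
  assumes "P \<in> index" "Q \<in> index" "P \<subseteq> Q"
  shows trans_hom: "i_homomorphism \<O> (K P) (K Q) (trans P Q)"
    and trans_g: "\<And>p. p \<in> generators P \<Longrightarrow> map (trans P Q) (g P p) = g Q p"
proof -
  have "satisfies (generators Q) fst Q (K Q) (g Q)"
    using K[OF assms(2)] by (simp add: presents_def)
  then have "satisfies (generators P) fst P (K Q) (g Q)"
    using assms(3) generators_mono[OF assms(3)] unfolding satisfies_def by blast
  then have "\<exists>!h. i_homomorphism \<O> (K P) (K Q) h \<and> (\<forall>p\<in>generators P. map h (g P p) = g Q p)"
    using K[OF assms(1)] K_Obj[OF assms(2)] by (simp add: presents_def)
  from someI_ex[OF ex1_implies_ex[OF this]]
  show "i_homomorphism \<O> (K P) (K Q) (trans P Q)"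
    "\<And>p. p \<in> generators P \<Longrightarrow> map (trans P Q) (g P p) = g Q p"
    by (simp_all add: trans_def)
qed

text \<open>Functoriality is checked on generators, which the transition maps send to the generators
  of the same name.\<close>

lemma trans_refl:
  assumes P: "P \<in> index"
  shows "trans P P = (\<lambda>x\<in>carr (K P). x)"
proof (rule K_hom_eqI[OF P K_Obj[OF P] trans_hom[OF P P order_refl] hom_idn[OF K_algebra[OF P]]])
  fix p assume p: "p \<in> generators P"
  interpret i_algebra \<O> "K P" by (rule K_algebra[OF P])
  have "map (\<lambda>x\<in>carr (K P). x) (g P p) = g P p"
    using nbh_set[OF g_nbh[OF P p]] by (intro map_idI) auto
  then show "map (trans P P) (g P p) = map (\<lambda>x\<in>carr (K P). x) (g P p)"
    by (simp only: trans_g[OF P P order_refl p])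
qed

lemma trans_trans:
  assumes P: "P \<in> index" and Q: "Q \<in> index" and R: "R \<in> index" and le: "P \<subseteq> Q" "Q \<subseteq> R"
  shows "trans P R = compose (carr (K P)) (trans Q R) (trans P Q)"
proof -
  have le': "P \<subseteq> R" using le by (rule order_trans)
  show ?thesis
  proof (rule K_hom_eqI[OF P K_Obj[OF R] trans_hom[OF P R le']
        hom_compose[OF K_algebra[OF P] trans_hom[OF P Q le(1)] trans_hom[OF Q R le(2)]]])
    fix p assume p: "p \<in> generators P"
    then have "p \<in> generators Q" using generators_mono[OF le(1)] by blast
    then show "map (trans P R) (g P p) = map (compose (carr (K P)) (trans Q R) (trans P Q)) (g P p)"
      by (simp only: map_compose_g[OF P p] trans_g[OF P Q le(1) p] trans_g[OF P R le' p] trans_g[OF Q R le(2)])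
  qed
qed

lemma to_X_trans:
  assumes P: "P \<in> index" and Q: "Q \<in> index" and le: "P \<subseteq> Q"
  shows "to_X P = compose (carr (K P)) (to_X Q) (trans P Q)"
proof (rule K_hom_eqI[OF P X to_X_hom[OF P]
      hom_compose[OF K_algebra[OF P] trans_hom[OF P Q le] to_X_hom[OF Q]]])
  fix p assume p: "p \<in> generators P"
  then have "p \<in> generators Q" using generators_mono[OF le] by blast
  then show "map (to_X P) (g P p) = map (compose (carr (K P)) (to_X Q) (trans P Q)) (g P p)"
    by (simp only: map_compose_g[OF P p] trans_g[OF P Q le p] to_X_g[OF P p] to_X_g[OF Q])
qed

text \<open>A neighbourhood of positive arity becomes a generator through the reflexive relation on
  its first projection. Arity 0 has no projection, but the empty tuple is always among the
  generators.\<close>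

lemma cover_exists:
  assumes "p \<in> neighbourhoods X"
  shows "\<exists>P\<in>index. p \<in> generators P"
proof (cases "fst p = 0")
  case True
  then have "p = (0, [])" using assms by (auto simp: neighbourhoods_def X.nbh_Nil)
  then show ?thesis by (intro bexI[of _ "{}"]) (auto simp: generators_def Fpow_def)
next
  case False
  let ?P = "{((p, prj \<O> (fst p) 0), (p, prj \<O> (fst p) 0))}"
  have "?P \<in> index"
    using False assms is_clone.prj_closed[OF clone] by (auto simp: Fpow_def relations_def)
  moreover have "p \<in> generators ?P" by (simp add: generators_def)
  ultimately show ?thesis by blast
qed

text \<open>A compatible family assigns to each neighbourhood \<open>p\<close> of \<open>X\<close> a
  neighbourhood \<open>v p\<close> of \<open>Y\<close>, and every relation of \<open>X\<close> is
  respected because it is already present at the stage consisting of that relation alone.\<close>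

lemma universal:
  fixes Y :: "('f, 'u) ialg"
  assumes Y: "Y \<in> Obj (iAlg \<O>)"
    and f: "\<And>P. P \<in> index \<Longrightarrow> i_homomorphism \<O> (K P) Y (f P)"
    and f_trans: "\<And>P Q. \<lbrakk>P \<in> index; Q \<in> index; P \<subseteq> Q\<rbrakk> \<Longrightarrow> compose (carr (K P)) (f Q) (trans P Q) = f P"
  shows "\<exists>!m. i_homomorphism \<O> X Y m \<and> (\<forall>P\<in>index. compose (carr (K P)) m (to_X P) = f P)"
proof -
  interpret Y: i_algebra \<O> Y using Y by (simp add: iAlg_Obj)
  have f_g: "map (f Q) (g Q p) = map (f P) (g P p)"
    if "P \<in> index" "Q \<in> index" "P \<subseteq> Q" and p: "p \<in> generators P" for P Q p
    using map_compose_g[OF that(1) p, of "f Q" "trans P Q"] trans_g[OF that]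
    by (simp only: f_trans[OF that(1-3)])
  define cover where "cover p = (SOME P. P \<in> index \<and> p \<in> generators P)" for p
  have cover: "cover p \<in> index" "p \<in> generators (cover p)" if "p \<in> neighbourhoods X" for p
    using someI_ex[of "\<lambda>P. P \<in> index \<and> p \<in> generators P"] cover_exists[OF that]
    unfolding cover_def by blast+
  define v where "v p = map (f (cover p)) (g (cover p) p)" for p
  have generators_neighbourhoods: "p \<in> neighbourhoods X" if "P \<in> index" "p \<in> generators P" for P p
    using generators_nbh[OF that] by (cases p) (simp add: neighbourhoods_def)
  \<comment> \<open>Independence of the stage: two stages having \<open>p\<close> as generator are
    compared at their union.\<close>
  have v: "map (f P) (g P p) = v p" if P: "P \<in> index" and p: "p \<in> generators P" for P p
  proof -
    note c = cover[OF generators_neighbourhoods[OF P p]]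
    have "P \<union> cover p \<in> index" using P c by (auto simp: Fpow_def)
    then show ?thesis
      using f_g[of P "P \<union> cover p" p] f_g[of "cover p" "P \<union> cover p" p] P p c by (simp add: v_def)
  qed
  have v_nbh: "v p \<in> Nbh Y (fst p)" if "p \<in> neighbourhoods X" for p
    unfolding v_def by (rule hom_nbh[OF f g_nbh]) (use cover[OF that] in simp_all)
  have v_relation: "act Y (fst p) \<sigma> (v p) = act Y (fst p') \<tau> (v p')"
    if r: "((p, \<sigma>), (p', \<tau>)) \<in> relations \<O> X" for p \<sigma> p' \<tau>
  proof -
    let ?P = "{((p, \<sigma>), (p', \<tau>))}"
    have P: "?P \<in> index" using r by (simp add: Fpow_def)
    have p: "p \<in> generators ?P" "p' \<in> generators ?P" by (simp_all add: generators_def)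
    have \<sigma>: "\<sigma> \<in> Ops \<O> (fst p)" "\<tau> \<in> Ops \<O> (fst p')" using r by (auto simp: relations_def)
    have "act (K ?P) (fst p) \<sigma> (g ?P p) = act (K ?P) (fst p') \<tau> (g ?P p')"
      by (rule presents_relation[OF K[OF P]]) simp
    then have "act Y (fst p) \<sigma> (map (f ?P) (g ?P p)) = act Y (fst p') \<tau> (map (f ?P) (g ?P p'))"
      using hom_act[OF f[OF P] \<sigma>(1) g_nbh[OF P p(1)]] hom_act[OF f[OF P] \<sigma>(2) g_nbh[OF P p(2)]] by simp
    then show ?thesis by (simp only: v[OF P p(1)] v[OF P p(2)])
  qed
  have single: "(1, [x]) \<in> neighbourhoods X" if "x \<in> carr X" for x
    using that X.nbh_single by (simp add: neighbourhoods_def)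
  \<comment> \<open>An element is read as a neighbourhood of length 1, and the only entry of its
    value is taken.\<close>
  define m where "m = (\<lambda>x\<in>carr X. v (1, [x]) ! 0)"
  have m_act: "m (act X n \<sigma> xs) = act Y n \<sigma> (v (n, xs))" if \<sigma>: "\<sigma> \<in> Ops \<O> n" and xs: "xs \<in> Nbh X n" for n \<sigma> xs
  proof -
    let ?y = "act X n \<sigma> xs"
    have y: "?y \<in> carr X" by (rule X.act_closed[OF \<sigma> xs])
    \<comment> \<open>That \<open>?y\<close> is the value of \<sigma> at \<open>xs\<close> is itself
      a relation of \<open>X\<close>, between the neighbourhoods \<open>[?y]\<close> and
      \<open>xs\<close>.\<close>
    have "((( 1, [?y]), prj \<O> 1 0), ((n, xs), \<sigma>)) \<in> relations \<O> X"
      using single[OF y] \<sigma> xs is_clone.prj_closed[OF clone, of 0 1] X.projection[of 0 1 "[?y]"] X.nbh_single[of ?y] y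
      by (simp add: relations_def neighbourhoods_def)
    from v_relation[OF this] have "act Y 1 (prj \<O> 1 0) (v (1, [?y])) = act Y n \<sigma> (v (n, xs))" by simp
    then show ?thesis
      using Y.projection[of 0 1 "v (1, [?y])"] v_nbh[OF single[OF y]] y by (simp add: m_def)
  qed
  have m_v: "map m xs = v (n, xs)" if xs: "xs \<in> Nbh X n" for n xs
  proof (rule nth_equalityI)
    have v_xs: "v (n, xs) \<in> Nbh Y n" using v_nbh[of "(n, xs)"] xs by (simp add: neighbourhoods_def)
    then show "length (map m xs) = length (v (n, xs))"
      using X.nbh_length[OF xs] Y.nbh_length by simp
    fix j assume "j < length (map m xs)"
    then have j: "j < n" using X.nbh_length[OF xs] by simp
    \<comment> \<open>The entry \<open>xs ! j\<close> is the projection applied to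
      \<open>xs\<close>, so \<open>m_act\<close> applies to it.\<close>
    have "m (xs ! j) = v (n, xs) ! j"
      using m_act[OF is_clone.prj_closed[OF clone j] xs] X.projection[OF j xs] Y.projection[OF j v_xs] by simp
    then show "map m xs ! j = v (n, xs) ! j" using j X.nbh_length[OF xs] by simp
  qed
  have m: "i_homomorphism \<O> X Y m"
  proof (rule homI)
    show "m \<in> extensional (carr X)" by (simp add: m_def)
    show "m x \<in> carr Y" if "x \<in> carr X" for x
      using Y.nbh_nth[OF v_nbh[OF single[OF that]], of 0] that by (simp add: m_def)
    show "map m xs \<in> Nbh Y n" if "xs \<in> Nbh X n" for n xs
      using v_nbh[of "(n, xs)"] that by (simp add: m_v neighbourhoods_def)
    show "m (act X n \<sigma> xs) = act Y n \<sigma> (map m xs)" if "\<sigma> \<in> Ops \<O> n" "xs \<in> Nbh X n" for n \<sigma> xs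
      using m_act[OF that] m_v[OF that(2)] by simp
  qed
  have m_to_X: "compose (carr (K P)) m (to_X P) = f P" if P: "P \<in> index" for P
  proof (rule K_hom_eqI[OF P Y hom_compose[OF K_algebra[OF P] to_X_hom[OF P] m] f[OF P]])
    fix p assume p: "p \<in> generators P"
    have "map m (snd p) = v (fst p, snd p)" by (rule m_v[OF generators_nbh[OF P p]])
    then show "map (compose (carr (K P)) m (to_X P)) (g P p) = map (f P) (g P p)"
      by (simp only: map_compose_g[OF P p] to_X_g[OF P p] v[OF P p] prod.collapse)
  qed
  have unique: "m' = m" if m': "i_homomorphism \<O> X Y m'" and eq: "\<forall>P\<in>index. compose (carr (K P)) m' (to_X P) = f P" for m'
  proof (rule hom_eqI[OF m' m])
    fix x assume x: "x \<in> carr X"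
    note c = cover[OF single[OF x]]
    let ?P = "cover (1, [x])"
    \<comment> \<open>The tuple \<open>[x]\<close> is the image of a generator under
      \<open>to_X\<close>, which forces the value of any mediating map at \<open>x\<close>.\<close>
    have "map m' (map (to_X ?P) (g ?P (1, [x]))) = map (f ?P) (g ?P (1, [x]))"
      by (simp only: map_compose_g[OF c, symmetric] eq[rule_format, OF c(1)])
    then have "map m' [x] = v (1, [x])"
      by (simp only: to_X_g[OF c] v[OF c] snd_conv)
    from arg_cong[OF this, of "\<lambda>l. l ! 0"] show "m' x = m x" using x by (simp add: m_def)
  qed
  show ?thesis
  proof (rule ex1I[of _ m])
    show "i_homomorphism \<O> X Y m \<and> (\<forall>P\<in>index. compose (carr (K P)) m (to_X P) = f P)"
      using m m_to_X by simp
  qed (elim conjE, rule unique)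
qed

section \<open>The index poset as a small category with objects in \<open>'u\<close>\<close>

lemma small_index: "small TYPE('u) index"
proof (rule small_Fpow[OF U])
  have "small TYPE('u) (carr X)" using X by (simp add: iAlg_Obj)
  then have "small TYPE('u) (Nbh X n)" for n
    using small_subset[OF X.nbh_subset small_tuples[OF U]] by blast
  then have points: "small TYPE('u) (SIGMA p:neighbourhoods X. Ops \<O> (fst p))"
    unfolding neighbourhoods_def by (intro small_Sigma U small_nat small_Ops)
  have "small TYPE('u) ((SIGMA p:neighbourhoods X. Ops \<O> (fst p)) \<times> (SIGMA p:neighbourhoods X. Ops \<O> (fst p)))"
    by (rule small_Sigma[OF U points points])
  then show "small TYPE('u) (relations \<O> X)"
    by (rule small_subset[rotated]) (auto simp: relations_def)
qed

text \<open>Diagram shapes must have their objects in \<open>'u\<close>, whereas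
  \<open>index\<close> consists of sets of relations; its smallness permits a renaming.\<close>

definition code :: "(((nat \<times> 'u list) \<times> 'f) \<times> ((nat \<times> 'u list) \<times> 'f)) set \<Rightarrow> 'u" where
  "code = (SOME e. inj_on e index)"

lemma inj_code: "inj_on code index"
proof -
  obtain e :: "_ \<Rightarrow> 'u" where "inj_on e index" using small_encoding[OF small_index] .
  then show ?thesis unfolding code_def by (rule someI[of "\<lambda>e. inj_on e index"])
qed

definition decode where "decode = inv_into index code"

lemma decode_code: "P \<in> index \<Longrightarrow> decode (code P) = P"
  unfolding decode_def by (rule inv_into_f_f[OF inj_code])

text \<open>Inclusion of finite sets, transported along \<open>code\<close>. One value can serve as
  every arrow because hom-sets of different pairs may overlap.\<close>

definition J :: "('u, 'u) category" where
  "J = \<lparr>Obj = code ` index, Hom = (\<lambda>i j. if decode i \<subseteq> decode j then {undefined} else {}),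
        Idn = (\<lambda>_. undefined), Cmp = (\<lambda>_ _ _ _ _. undefined)\<rparr>"

lemma J_Obj: "i \<in> Obj J \<Longrightarrow> decode i \<in> index"
  by (auto simp: J_def decode_code)

lemma J_Hom: "Hom J i j \<noteq> {} \<longleftrightarrow> decode i \<subseteq> decode j" "u \<in> Hom J i j \<Longrightarrow> decode i \<subseteq> decode j"
  by (auto simp: J_def split: if_splits)

lemma J_category: "is_category J"
  by standard (auto simp: J_def split: if_splits)

lemma J_small: "small_category J"
  unfolding small_category_def
  using J_category small_image[OF small_index] by (auto simp: J_def small_finite[OF U])

lemma J_directed: "directed_poset J"
  unfolding directed_poset_def J_Hom
proof (intro conjI ballI impI)
  show "\<exists>k\<in>Obj J. decode i \<subseteq> decode k \<and> decode j \<subseteq> decode k" if "i \<in> Obj J" "j \<in> Obj J" for i j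
  proof -
    have "decode i \<union> decode j \<in> index" using J_Obj that by (auto simp: Fpow_def)
    then show ?thesis
      by (intro bexI[of _ "code (decode i \<union> decode j)"]) (auto simp: decode_code J_def)
  qed
  show "i = j" if "i \<in> Obj J" "j \<in> Obj J" "decode i \<subseteq> decode j \<and> decode j \<subseteq> decode i" for i j
    using that by (auto simp: J_def decode_code)
  show "u = w" if "u \<in> Hom J i j" "w \<in> Hom J i j" for i j u w
    using that by (auto simp: J_def split: if_splits)
  show "Obj J \<noteq> {}" by (auto simp: J_def Fpow_def)
qed (rule J_category)

lemma J_functor: "is_functor J (iAlg \<O>) (\<lambda>i. K (decode i)) (\<lambda>i j _. trans (decode i) (decode j))"
proof (intro is_functor.intro is_functor_axioms.intro J_category iAlg_category)
  fix i j k u w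
  show "i \<in> Obj J \<Longrightarrow> K (decode i) \<in> Obj (iAlg \<O>)"
    by (rule K_Obj[OF J_Obj])
  show "i \<in> Obj J \<Longrightarrow> j \<in> Obj J \<Longrightarrow> u \<in> Hom J i j
    \<Longrightarrow> trans (decode i) (decode j) \<in> Hom (iAlg \<O>) (K (decode i)) (K (decode j))"
    unfolding iAlg_Hom by (rule trans_hom[OF J_Obj J_Obj J_Hom(2)])
  show "i \<in> Obj J \<Longrightarrow> trans (decode i) (decode i) = Idn (iAlg \<O>) (K (decode i))"
    unfolding iAlg_Idn by (rule trans_refl[OF J_Obj])
  show "i \<in> Obj J \<Longrightarrow> j \<in> Obj J \<Longrightarrow> k \<in> Obj J \<Longrightarrow> u \<in> Hom J i j \<Longrightarrow> w \<in> Hom J j k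
    \<Longrightarrow> trans (decode i) (decode k) = Cmp (iAlg \<O>) (K (decode i)) (K (decode j)) (K (decode k))
          (trans (decode j) (decode k)) (trans (decode i) (decode j))"
    unfolding iAlg_Cmp by (rule trans_trans[OF J_Obj J_Obj J_Obj J_Hom(2) J_Hom(2)])
qed

text \<open>A cocone over \<open>J\<close> is read through \<open>code\<close> as a compatible
  family over \<open>index\<close>, to which \<open>universal\<close> applies.\<close>

lemma J_colimit:
  "is_colimit J (iAlg \<O>) (\<lambda>i. K (decode i)) (\<lambda>i j _. trans (decode i) (decode j)) X (\<lambda>i. to_X (decode i))"
  unfolding is_colimit_def
proof (intro conjI allI impI)
  show "is_cocone J (iAlg \<O>) (\<lambda>i. K (decode i)) (\<lambda>i j _. trans (decode i) (decode j)) X (\<lambda>i. to_X (decode i))"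
    unfolding is_cocone_def iAlg_Hom iAlg_Cmp
    using X to_X_hom[OF J_Obj] to_X_trans[OF J_Obj J_Obj J_Hom(2)] by simp
  fix Y l assume c: "is_cocone J (iAlg \<O>) (\<lambda>i. K (decode i)) (\<lambda>i j _. trans (decode i) (decode j)) Y l"
  have Obj_J: "code P \<in> Obj J" if "P \<in> index" for P using that by (simp add: J_def)
  have "\<exists>!m. i_homomorphism \<O> X Y m \<and> (\<forall>P\<in>index. compose (carr (K P)) m (to_X P) = l (code P))"
  proof (rule universal)
    show "Y \<in> Obj (iAlg \<O>)" using c by (simp add: is_cocone_def)
    show "i_homomorphism \<O> (K P) Y (l (code P))" if "P \<in> index" for P
      using c Obj_J[OF that] decode_code[OF that] unfolding is_cocone_def iAlg_Hom by metis
    fix P Q assume P: "P \<in> index" "Q \<in> index" "P \<subseteq> Q"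
    then have "undefined \<in> Hom J (code P) (code Q)" by (simp add: J_def decode_code)
    then show "compose (carr (K P)) (l (code Q)) (trans P Q) = l (code P)"
      using c Obj_J[OF P(1)] Obj_J[OF P(2)] decode_code[OF P(1)] decode_code[OF P(2)]
      unfolding is_cocone_def iAlg_Cmp by metis
  qed
  moreover have "(\<forall>P\<in>index. compose (carr (K P)) m (to_X P) = l (code P)) \<longleftrightarrow>
      (\<forall>i\<in>Obj J. compose (carr (K (decode i))) m (to_X (decode i)) = l i)" for m
    by (auto simp: J_def decode_code)
  ultimately show "\<exists>!m. m \<in> Hom (iAlg \<O>) X Y \<and>
      (\<forall>i\<in>Obj J. Cmp (iAlg \<O>) (K (decode i)) X Y m (to_X (decode i)) = l i)"
    unfolding iAlg_Hom iAlg_Cmp by simp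
qed

end

theorem theorem4p3:
  fixes \<O> :: "'f clone"
  assumes "universe TYPE('u)"
    and "is_clone \<O>"
    and "\<And>n. small TYPE('u) (Ops \<O> n)"
  shows "locally_finitely_presentable TYPE('u) (iAlg \<O> :: (('f, 'u) ialg, 'u \<Rightarrow> 'u) category)"
proof -
  let ?C = "iAlg \<O> :: (('f, 'u) ialg, 'u \<Rightarrow> 'u) category"
  \<comment> \<open>Generators are named by neighbourhoods with their arity, a type that does not
    mention \<open>X\<close>, so one set \<open>S\<close> serves all algebras.\<close>
  obtain S :: "('f, 'u) ialg set" where S: "small TYPE('u) S"
    "\<And>K. K \<in> S \<Longrightarrow> finitely_presentable TYPE('u) (iAlg \<O>) K"
    and presented: "\<And>(N :: (nat \<times> 'u list) set) ar R.
      \<lbrakk>finite N; N \<noteq> {}; finite R; valid_relations \<O> N ar R\<rbrakk> \<Longrightarrow> \<exists>K\<in>S. \<exists>g. presents \<O> N ar R K g"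
    using finite_presentations[OF assms] by metis
  have "\<exists>(J :: ('u, 'u) category) D Da l. small_category J \<and> directed_poset J \<and> is_functor J ?C D Da
      \<and> (\<forall>i\<in>Obj J. D i \<in> S) \<and> is_colimit J ?C D Da X l" if X: "X \<in> Obj ?C" for X
  proof -
    interpret X: i_algebra \<O> X using X by (simp add: iAlg_Obj)
    have "\<exists>K\<in>S. \<exists>g. presents \<O> (generators P) fst P K g" if P: "P \<in> Fpow (relations \<O> X)" for P
    proof (rule presented)
      show "valid_relations \<O> (generators P) fst P"
        using P by (intro relations_valid[of P \<O> X]) (simp add: Fpow_def)
    qed (use P in \<open>auto simp: Fpow_def generators_def\<close>)
    \<comment> \<open>The stages are taken from \<open>S\<close> itself, so the diagram lies in
      \<open>S\<close> on the nose and not merely up to isomorphism.\<close>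
    then obtain K where K_S: "\<forall>P\<in>Fpow (relations \<O> X). K P \<in> S \<and> (\<exists>g. presents \<O> (generators P) fst P (K P) g)"
      by metis
    then obtain g where g: "\<forall>P\<in>Fpow (relations \<O> X). presents \<O> (generators P) fst P (K P) (g P)"
      by metis
    interpret approximation \<O> X K g
      using assms X g by (intro approximation.intro) simp_all
    show ?thesis
    proof (intro exI conjI ballI)
      show "small_category J" "directed_poset J" by (rule J_small J_directed)+
      show "is_functor J ?C (\<lambda>i. K (decode i)) (\<lambda>i j _. trans (decode i) (decode j))"
        by (rule J_functor)
      show "K (decode i) \<in> S" if "i \<in> Obj J" for i using K_S J_Obj[OF that] by simp
      show "is_colimit J ?C (\<lambda>i. K (decode i)) (\<lambda>i j _. trans (decode i) (decode j)) X
          (\<lambda>i. to_X (decode i))"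
        by (rule J_colimit)
    qed
  qed
  then show ?thesis
    unfolding locally_finitely_presentable_def
    by (intro conjI exI[of _ S] ballI iAlg_category iAlg_locally_small[OF assms(1)]
        iAlg_cocomplete[OF assms] S)
qed

end
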